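(* Let $\alpha>-1$, $\eta>-3$, $q\in\left(0,\frac{3+\eta}{1+\alpha}\right)$ and $S_0>0$. Let $V=V(y,s)\in C^1(\mathbb{R}^{3+1})$ be a solution, time periodic with period $S_0$ (i.e. $V(y,s)=V(y,s+S_0)$ for all $(y,s)\in\mathbb{R}^{3+1}$), of $$V_s+\frac{\alpha}{\alpha+1}V+\frac{1}{\alpha+1}(y\cdot\nabla)V+(V\cdot\nabla)V=-\nabla P,\qquad \mathrm{div}\,V=0,$$ with some pressure $P=P(y,s)$. Put $\Omega=\mathrm{curl}\,V$, and suppose that $$\lim_{|y|\to\infty}\sup_{0<s<S_0}|\nabla V(y,s)|=0$$ and $$\int_0^{S_0}\int_{\mathbb{R}^3}|\Omega(y,s)|^q(1+|y|)^\eta\,dy\,ds<\infty.$$ Then $\Omega=0$. If, in addition, $\lim_{|y|\to\infty}V(y,s)=0$ for all $s\in[0,S_0)$, then $V=0$.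
   Context: Here $y\in\mathbb{R}^3$, $s\in\mathbb{R}$, $V$ takes values in $\mathbb{R}^3$ and $P$ in $\mathbb{R}$; the operators $\nabla$, $\mathrm{div}$, $\mathrm{curl}$ act in the variable $y$, and $V_s=\partial_sV$. *)

theory Defs
  imports "HOL-Analysis.Analysis"
begin

text \<open>The entry \<open>jacobian f (at y) $ i $ j\<close> is the partial derivative of \<open>f\<^sub>i\<close> with respect to
  \<open>y\<^sub>j\<close>; hence \<open>(W \<cdot> \<nabla>)f\<close> at \<open>y\<close> is \<open>jacobian f (at y) *v W\<close>.\<close>

definition divergence :: "(real^3 \<Rightarrow> real^3) \<Rightarrow> real^3 \<Rightarrow> real"
  where "divergence f y = (\<Sum>i\<in>UNIV. jacobian f (at y) $ i $ i)"

definition curl :: "(real^3 \<Rightarrow> real^3) \<Rightarrow> real^3 \<Rightarrow> real^3"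
  where "curl f y = (let J = jacobian f (at y) in
    vector [J$3$2 - J$2$3, J$1$3 - J$3$1, J$2$1 - J$1$2])"

definition C1 :: "('a::real_normed_vector \<Rightarrow> 'b::real_normed_vector) \<Rightarrow> bool"
  where "C1 f \<longleftrightarrow> (\<exists>f' :: 'a \<Rightarrow> 'a \<Rightarrow>\<^sub>L 'b.
    (\<forall>x. (f has_derivative blinfun_apply (f' x)) (at x)) \<and> continuous_on UNIV f')"

text \<open>For a \<open>C\<^sup>1\<close> profile \<open>V\<close> the momentum equation makes \<open>\<nabla>P\<close> continuous, so differentiability of
  \<open>P\<close> in the space variable is the only regularity required of the pressure. Here \<open>G\<close> is the
  gradient of \<open>P\<close> in \<open>y\<close>.\<close>

definition solves_profile_equations ::
    "real \<Rightarrow> (real^3 \<Rightarrow> real \<Rightarrow> real^3) \<Rightarrow> (real^3 \<Rightarrow> real \<Rightarrow> real) \<Rightarrow> bool"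
  where "solves_profile_equations \<alpha> V P \<longleftrightarrow>
    (\<forall>y s. (\<exists>G. GDERIV (\<lambda>x. P x s) y :> G \<and>
        vector_derivative (\<lambda>t. V y t) (at s)
        + (\<alpha> / (\<alpha> + 1)) *\<^sub>R V y s
        + (1 / (\<alpha> + 1)) *\<^sub>R (jacobian (\<lambda>x. V x s) (at y) *v y)
        + jacobian (\<lambda>x. V x s) (at y) *v V y s = - G)
      \<and> divergence (\<lambda>x. V x s) y = 0)"

end

theory Submission
  imports Defs
begin

text \<open>Write \<open>b = 1 / (\<alpha> + 1)\<close>, \<open>a = \<alpha> / (\<alpha> + 1)\<close>, so \<open>a + b = 1\<close>, and let \<open>W = V + b y\<close> be the field
  that transports the vorticity in self-similar variables. Its divergence is \<open>3 b > 0\<close>: the flow of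
  \<open>W\<close> expands volumes at a constant exponential rate, and this expansion over one period is what
  periodicity cannot tolerate.

  The argument is Lagrangian. Since \<open>\<nabla>V\<close> is continuous, periodic in time and small at infinity, it
  is bounded, so \<open>W\<close> is globally Lipschitz in space and has a \<open>C\<^sup>1\<close> flow \<open>X\<close> with spatial Jacobian
  matrix \<open>Y\<close>. As \<open>V\<close> is only \<open>C\<^sup>1\<close>, the vorticity \<open>\<Omega>\<close> is merely continuous and its evolution
  equation has no classical meaning. It is replaced by Cauchy's formula
  \<open>\<Omega>(X(t)) = exp (- (a + 2 b) t) Y(t) \<Omega>(0)\<close>, obtained as follows: the momentum equation says that
  the circulation of \<open>V\<close> around a transported loop only changes by the factor \<open>exp (- (a - b) t)\<close>
  (\<open>kelvin_circulation\<close>, where the pressure drops out because it is integrated along a closed loop);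
  dividing by the area of a shrinking loop (\<open>circulation_density\<close>) and using
  \<open>det Y = exp (3 b t)\<close> gives the formula (\<open>cauchy_vorticity_formula\<close>).

  Far from the origin \<open>V\<close> is a small perturbation of \<open>b y\<close>. Up to an arbitrarily small loss
  in the exponents, trajectories starting there satisfy \<open>|X| \<approx> exp (b t)\<close>, and \<open>|\<Omega>|\<close> decays like
  \<open>exp (- t)\<close> along them. Hence \<open>|\<Omega>|\<^sup>q |y|\<^sup>\<eta> dy\<close> grows like \<open>exp ((b (3 + \<eta>) - q) t)\<close>, with a
  positive exponent because \<open>q < (3 + \<eta>) / (1 + \<alpha>)\<close>. The map over one period sends the exterior
  region into itself and \<open>\<Omega>\<close> is periodic, so the integral of this density over the exterior region,
  if finite, is at least a factor \<open>> 1\<close> times itself, that is, zero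
  (\<open>weighted_vorticity_expands\<close>, \<open>expanding_self_map_vanishing\<close>). So the vorticity has bounded
  support. By Cauchy's formula the period map sends the open set \<open>{\<Omega> \<noteq> 0}\<close> into itself, and it
  multiplies its finite volume by \<open>exp (3 b S\<^sub>0) > 1\<close>; hence this set is empty.

  For the last claim, \<open>V\<close> is free of curl and divergence and tends to zero. For each \<open>h\<close> the line
  integral of \<open>V\<close> from \<open>x\<close> to \<open>x + h\<close> is then a \<open>C\<^sup>2\<close> harmonic function of \<open>x\<close> that tends to zero,
  so it vanishes by the maximum principle, and so does its gradient \<open>V(x + h) - V(x)\<close>.\<close>

section \<open>Exponential comparison and global solutions of Lipschitz equations\<close>

text \<open>All growth estimates reduce to this one, which says that \<open>exp (- c t) u(t) - d t\<close> is
  non-increasing. The constant \<open>c\<close> may have either sign.\<close>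

lemma exponential_comparison:
  fixes u u' :: "real \<Rightarrow> real"
  assumes der: "\<And>t. t \<in> {0..T} \<Longrightarrow> (u has_vector_derivative u' t) (at t within {0..T})"
    and le: "\<And>t. t \<in> {0..T} \<Longrightarrow> u' t \<le> c * u t + d * exp (c * t)"
    and t: "t \<in> {0..T}"
  shows "u t \<le> exp (c * t) * (u 0 + d * t)"
proof -
  define w where "w r = exp (- (c * r)) * u r - d * r" for r
  have wder: "(w has_real_derivative (exp (- (c * r)) * (u' r - c * u r) - d)) (at r within {0..T})"
    if "r \<in> {0..T}" for r
  proof -
    have "(u has_real_derivative u' r) (at r within {0..T})"
      using der[OF that] by (simp add: has_real_derivative_iff_has_vector_derivative)
    then show ?thesis
      unfolding w_def by (auto simp: algebra_simps intro!: derivative_eq_intros)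
  qed
  have "w t \<le> w 0"
  proof (rule DERIV_nonpos_imp_decreasing_open[of 0 t w])
    show "0 \<le> t" using t by simp
    fix r assume r: "0 < r" "r < t"
    with t have rT: "r \<in> {0..T}" "0 < r" "r < T" by auto
    have "(w has_real_derivative (exp (- (c * r)) * (u' r - c * u r) - d)) (at r)"
      using wder[OF rT(1)] at_within_Icc_at[OF rT(2,3)] by simp
    moreover have "exp (- (c * r)) * (u' r - c * u r) - d \<le> 0"
    proof -
      have "exp (- (c * r)) * (u' r - c * u r) \<le> exp (- (c * r)) * (d * exp (c * r))"
        using le[OF rT(1)] by (intro mult_left_mono) auto
      also have "\<dots> = d" by (simp add: exp_minus)
      finally show ?thesis by simp
    qed
    ultimately show "\<exists>y. (w has_real_derivative y) (at r) \<and> y \<le> 0" by blast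
  next
    have "continuous_on {0..T} w"
      using wder by (intro DERIV_continuous_on)
    then show "continuous_on {0..t} w"
      by (rule continuous_on_subset) (use t in auto)
  qed
  then have "exp (- (c * t)) * u t \<le> u 0 + d * t" by (simp add: w_def)
  then have "exp (c * t) * (exp (- (c * t)) * u t) \<le> exp (c * t) * (u 0 + d * t)"
    by (intro mult_left_mono) auto
  then show ?thesis by (simp add: mult.assoc[symmetric] exp_add[symmetric])
qed

lemma exponential_lower_comparison:
  fixes u u' :: "real \<Rightarrow> real"
  assumes der: "\<And>t. t \<in> {0..T} \<Longrightarrow> (u has_vector_derivative u' t) (at t within {0..T})"
    and le: "\<And>t. t \<in> {0..T} \<Longrightarrow> c * u t \<le> u' t"
    and t: "t \<in> {0..T}"
  shows "exp (c * t) * u 0 \<le> u t"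
proof -
  have "- u t \<le> exp (c * t) * (- u 0 + 0 * t)"
    by (rule exponential_comparison[where T = T and u' = "\<lambda>t. - u' t"])
      (use assms in \<open>auto intro!: derivative_eq_intros\<close>)
  then show ?thesis by simp
qed

lemma norm_square_has_derivative:
  fixes z :: "real \<Rightarrow> 'a::real_inner"
  assumes "(z has_vector_derivative z') (at t within S)"
  shows "((\<lambda>t. (norm (z t))\<^sup>2) has_vector_derivative 2 * (z t \<bullet> z')) (at t within S)"
  unfolding power2_norm_eq_inner
  using has_derivative_inner[OF assms[unfolded has_vector_derivative_def]
      assms[unfolded has_vector_derivative_def]]
  by (simp add: has_vector_derivative_def inner_commute algebra_simps)

text \<open>Gronwall constant for the norm of a vector-valued function on \<open>[0, T]\<close>. The norm is not
  differentiable at zero, so the squared norm is estimated instead; the exponent \<open>2 L + 1\<close> comes from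
  \<open>2 |z| \<rho> \<le> |z|\<^sup>2 + \<rho>\<^sup>2\<close>, and \<open>1 + T\<close> bounds the contribution of \<open>\<rho>\<^sup>2\<close> accumulated over time.\<close>

definition growth :: "real \<Rightarrow> real \<Rightarrow> real"
  where "growth L T = sqrt (exp ((2 * L + 1) * T) * (1 + T))"

lemma gronwall_norm:
  fixes z z' :: "real \<Rightarrow> 'a::real_inner"
  assumes der: "\<And>t. t \<in> {0..T} \<Longrightarrow> (z has_vector_derivative z' t) (at t within {0..T})"
    and le: "\<And>t. t \<in> {0..T} \<Longrightarrow> norm (z' t) \<le> L * norm (z t) + \<rho>"
    and "0 \<le> L" "0 \<le> \<rho>" and t: "t \<in> {0..T}"
  shows "norm (z t) \<le> growth L T * (norm (z 0) + \<rho>)"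
proof (rule power2_le_imp_le)
  have T: "0 \<le> T" using t by auto
  have "(norm (z t))\<^sup>2 \<le> exp ((2 * L + 1) * t) * ((norm (z 0))\<^sup>2 + \<rho>\<^sup>2 * t)"
  proof (rule exponential_comparison[OF norm_square_has_derivative[OF der]])
    fix r assume r: "r \<in> {0..T}"
    have "z r \<bullet> z' r \<le> norm (z r) * norm (z' r)" by (rule norm_cauchy_schwarz)
    also have "\<dots> \<le> norm (z r) * (L * norm (z r) + \<rho>)"
      using le[OF r] by (intro mult_left_mono) auto
    finally have "2 * (z r \<bullet> z' r) \<le> 2 * L * (norm (z r))\<^sup>2 + 2 * norm (z r) * \<rho>"
      by (simp add: power2_eq_square algebra_simps)
    also have "2 * norm (z r) * \<rho> \<le> (norm (z r))\<^sup>2 + \<rho>\<^sup>2"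
      by (rule sum_squares_bound)
    also have "\<rho>\<^sup>2 \<le> \<rho>\<^sup>2 * exp ((2 * L + 1) * r)"
      using r \<open>0 \<le> L\<close> mult_left_mono[of 1 "exp ((2 * L + 1) * r)" "\<rho>\<^sup>2"] by simp
    finally show "2 * (z r \<bullet> z' r) \<le> (2 * L + 1) * (norm (z r))\<^sup>2 + \<rho>\<^sup>2 * exp ((2 * L + 1) * r)"
      by (simp add: algebra_simps)
  qed (use t in auto)
  also have "\<dots> \<le> exp ((2 * L + 1) * T) * ((norm (z 0) + \<rho>)\<^sup>2 * (1 + T))"
  proof (intro mult_mono)
    have "(norm (z 0))\<^sup>2 + \<rho>\<^sup>2 * t \<le> (norm (z 0))\<^sup>2 * (1 + T) + \<rho>\<^sup>2 * (1 + T)"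
      using t by (intro add_mono mult_left_mono) (auto simp: algebra_simps)
    also have "\<dots> \<le> (norm (z 0) + \<rho>)\<^sup>2 * (1 + T)"
      unfolding distrib_right[symmetric] using T \<open>0 \<le> \<rho>\<close>
      by (intro mult_right_mono) (auto simp: power2_sum)
    finally show "(norm (z 0))\<^sup>2 + \<rho>\<^sup>2 * t \<le> (norm (z 0) + \<rho>)\<^sup>2 * (1 + T)" .
  qed (use t \<open>0 \<le> L\<close> in \<open>auto intro!: mult_left_mono\<close>)
  also have "\<dots> = (growth L T * (norm (z 0) + \<rho>))\<^sup>2"
    using T by (simp add: growth_def power_mult_distrib)
  finally show "(norm (z t))\<^sup>2 \<le> (growth L T * (norm (z 0) + \<rho>))\<^sup>2" .
  show "0 \<le> growth L T * (norm (z 0) + \<rho>)"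
    using T \<open>0 \<le> \<rho>\<close> by (simp add: growth_def)
qed

lemma growth_nonneg: "0 \<le> T \<Longrightarrow> 0 \<le> growth L T"
  by (simp add: growth_def)

text \<open>Banach's fixed point theorem on the whole interval at once: for
  \<open>u(t) = exp (- 2 K t) X(t)\<close> the Picard operator contracts by the factor \<open>1/2\<close> in the supremum norm, so
  that no continuation from short time intervals is needed.\<close>

theorem picard_global:
  fixes F :: "real \<Rightarrow> 'a::banach \<Rightarrow> 'a"
  assumes T: "0 \<le> T"
    and cont: "continuous_on ({0..T} \<times> UNIV) (\<lambda>(t, x). F t x)"
    and lip: "\<And>t x y. t \<in> {0..T} \<Longrightarrow> norm (F t x - F t y) \<le> L * norm (x - y)"
  obtains X where "X 0 = x0"
    "\<And>t. t \<in> {0..T} \<Longrightarrow> (X has_vector_derivative F t (X t)) (at t within {0..T})"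
proof -
  define K where "K = \<bar>L\<bar> + 1"
  have K: "K > 0" by (simp add: K_def)
  have lipK: "norm (F t x - F t y) \<le> K * norm (x - y)" if "t \<in> {0..T}" for t x y
    by (rule order_trans[OF lip[OF that]]) (auto simp: K_def intro!: mult_right_mono)
  define f where "f u r = F r (exp (2 * K * r) *\<^sub>R apply_bcontfun u r)" for u r
  have fcont: "continuous_on {0..T} (f u)" for u
  proof -
    have "continuous_on {0..T} (\<lambda>r. (r, exp (2 * K * r) *\<^sub>R apply_bcontfun u r))"
      by (intro continuous_intros continuous_on_apply_bcontfun)
    from continuous_on_compose2[OF cont this] show ?thesis
      by (auto simp: f_def)
  qed
  define g where "g u t = exp (- (2 * K * t)) *\<^sub>R (x0 + integral {0..t} (f u))" for u t
  have fint: "f u integrable_on {0..t}" if "t \<in> {0..T}" for u t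
    by (intro integrable_continuous_real continuous_on_subset[OF fcont]) (use that in auto)
  have gcont: "continuous_on (cbox 0 T) (g u)" for u
    unfolding g_def cbox_interval
    by (intro continuous_intros indefinite_integral_continuous_1 fint) (use T in auto)
  \<comment> \<open>Extending by the values at the end points turns functions on the interval into elements
    of the complete space of bounded continuous functions on the line.\<close>
  have "\<exists>G. \<forall>t. apply_bcontfun G t = g u (clamp 0 T t)" for u
    by (rule continuous_on_cbox_bcontfunE[OF gcont[of u]]) blast
  then obtain G where G: "\<And>u t. apply_bcontfun (G u) t = g u (clamp 0 T t)" by metis
  have "dist (G u) (G v) \<le> 1/2 * dist u v" for u v
  proof (rule dist_bound)
    fix t
    define r where "r = clamp 0 T t"
    have r: "r \<in> {0..T}"
      using clamp_in_interval[of 0 T t] T by (simp add: r_def)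
    have "norm (integral {0..r} (f u) - integral {0..r} (f v))
        = norm (integral {0..r} (\<lambda>s. f u s - f v s))"
      by (subst integral_diff) (auto intro: fint[OF r])
    also have "\<dots> \<le> integral {0..r} (\<lambda>s. K * exp (2 * K * s) * dist u v)"
    proof (rule integral_norm_bound_integral)
      show "(\<lambda>s. f u s - f v s) integrable_on {0..r}" by (intro integrable_diff fint r)
      show "(\<lambda>s. K * exp (2 * K * s) * dist u v) integrable_on {0..r}"
        by (intro integrable_continuous_real continuous_intros)
      fix s assume s: "s \<in> {0..r}"
      have "norm (f u s - f v s) \<le> K * norm (exp (2 * K * s) *\<^sub>R (u s - v s))"
        using lipK[of s] s r by (simp add: f_def scaleR_diff_right)
      also have "\<dots> = K * exp (2 * K * s) * dist (u s) (v s)"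
        by (simp add: dist_norm)
      also have "\<dots> \<le> K * exp (2 * K * s) * dist u v"
        using K by (intro mult_left_mono dist_bounded) auto
      finally show "norm (f u s - f v s) \<le> K * exp (2 * K * s) * dist u v" .
    qed
    also have "\<dots> = dist u v / 2 * exp (2 * K * r) - dist u v / 2 * exp (2 * K * 0)"
      by (intro integral_unique fundamental_theorem_of_calculus)
        (use r in \<open>auto simp: has_real_derivative_iff_has_vector_derivative[symmetric]
            intro!: derivative_eq_intros\<close>)
    also have "\<dots> \<le> dist u v / 2 * exp (2 * K * r)" by simp
    finally have *: "norm (integral {0..r} (f u) - integral {0..r} (f v))
        \<le> dist u v / 2 * exp (2 * K * r)" .
    have "dist (G u t) (G v t)
        = exp (- (2 * K * r)) * norm (integral {0..r} (f u) - integral {0..r} (f v))"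
      by (simp add: G g_def r_def[symmetric] dist_norm scaleR_diff_right[symmetric])
    also have "\<dots> \<le> exp (- (2 * K * r)) * (dist u v / 2 * exp (2 * K * r))"
      using * by (intro mult_left_mono) auto
    also have "\<dots> = 1/2 * dist u v" by (simp add: exp_minus)
    finally show "dist (G u t) (G v t) \<le> 1/2 * dist u v" .
  qed
  then have "\<exists>!u. G u = u" by (intro banach_fix_type[of "1/2"]) auto
  then obtain u where u: "G u = u" by blast
  define X where "X t = x0 + integral {0..t} (f u)" for t
  have uX: "u t = exp (- (2 * K * t)) *\<^sub>R X t" if "t \<in> {0..T}" for t
    using G[of u t] that T by (simp add: u g_def X_def)
  have fX: "f u t = F t (X t)" if "t \<in> {0..T}" for t
    by (simp add: f_def uX[OF that] exp_minus)
  show ?thesis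
  proof
    show "X 0 = x0" by (simp add: X_def)
    fix t assume t: "t \<in> {0..T}"
    have "((\<lambda>t. integral {0..t} (f u)) has_vector_derivative f u t) (at t within {0..T})"
      by (rule integral_has_vector_derivative[OF fcont t])
    from has_vector_derivative_add[OF has_vector_derivative_const[of x0] this]
    show "(X has_vector_derivative F t (X t)) (at t within {0..T})"
      using fX[OF t] by (simp add: X_def[abs_def])
  qed
qed

section \<open>The flow of a continuously differentiable Lipschitz field\<close>

lemma norm_matrix_vector_le:
  fixes M :: "real^'n^'m"
  shows "norm (M *v x) \<le> norm M * norm x"
proof -
  have "norm (M *v x) \<le> L2_set (\<lambda>i. norm (M $ i) * norm x) UNIV"
    unfolding norm_vec_def[of "M *v x"]
    by (rule L2_set_mono) (auto simp: matrix_vector_mul_component Cauchy_Schwarz_ineq2)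
  also have "\<dots> = norm M * norm x"
    by (simp add: norm_vec_def[of M] L2_set_left_distrib)
  finally show ?thesis .
qed

lemma bounded_bilinear_matrix_vector:
  "bounded_bilinear ((*v) :: real^'n^'m \<Rightarrow> real^'n \<Rightarrow> real^'m)"
proof
  show "\<exists>K. \<forall>(M::real^'n^'m) x. norm (M *v x) \<le> norm M * norm x * K"
    by (rule exI[of _ 1]) (simp add: norm_matrix_vector_le)
qed (simp_all add: matrix_vector_mult_add_rdistrib matrix_vector_right_distrib
    scaleR_matrix_vector_assoc[symmetric] matrix_vector_mult_scaleR)

lemmas continuous_on_matrix_vector [continuous_intros] =
  bounded_bilinear.continuous_on[OF bounded_bilinear_matrix_vector]

lemma has_vector_derivative_imp_continuous_on:
  assumes "\<And>t. t \<in> S \<Longrightarrow> (f has_vector_derivative f' t) (at t within S)"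
  shows "continuous_on S f"
  unfolding continuous_on_eq_continuous_within
  using assms has_vector_derivative_continuous by blast

text \<open>The closing step of most epsilon arguments below: a small \<open>d\<close> also for \<open>c = 0\<close>, where \<open>e / c\<close> would
  not do.\<close>

lemma small_factor:
  fixes c e :: real
  assumes "0 \<le> c" "0 < e"
  obtains d where "0 < d" "c * d < e"
proof
  show "0 < e / (c + 1)" using assms by simp
  show "c * (e / (c + 1)) < e"
    using assms by (simp add: field_simps)
qed

lemma continuous_on_Times_uniformly:
  fixes f :: "'a::metric_space \<Rightarrow> 'b::metric_space \<Rightarrow> 'c::metric_space"
  assumes f: "\<And>a. continuous_on S (f a)"
    and unif: "\<And>a e. e > 0 \<Longrightarrow> \<exists>d>0. \<forall>b t. dist b a < d \<longrightarrow> t \<in> S \<longrightarrow> dist (f b t) (f a t) < e"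
  shows "continuous_on (UNIV \<times> S) (\<lambda>(a, t). f a t)"
  unfolding continuous_on_iff
proof clarsimp
  fix a t and e :: real assume t: "t \<in> S" and e: "e > 0"
  obtain d1 where d1: "d1 > 0" "\<And>b t. dist b a < d1 \<Longrightarrow> t \<in> S \<Longrightarrow> dist (f b t) (f a t) < e / 2"
    using unif[of "e / 2" a] e by auto
  obtain d2 where d2: "d2 > 0" "\<And>r. r \<in> S \<Longrightarrow> dist r t < d2 \<Longrightarrow> dist (f a r) (f a t) < e / 2"
    using f[of a] t e unfolding continuous_on_iff by (meson half_gt_zero)
  have "dist (f b r) (f a t) < e" if "r \<in> S" "dist (b, r) (a, t) < min d1 d2" for b r
  proof -
    have "dist b a < d1" "dist r t < d2"
      using that dist_fst_le[of "(b, r)" "(a, t)"] dist_snd_le[of "(b, r)" "(a, t)"] by auto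
    then have "dist (f b r) (f a r) < e / 2" "dist (f a r) (f a t) < e / 2"
      using d1 d2 that by auto
    then show ?thesis using dist_triangle[of "f b r" "f a t" "f a r"] by linarith
  qed
  then show "\<exists>d>0. \<forall>b. \<forall>r\<in>S. dist (b, r) (a, t) < d \<longrightarrow> dist (f b r) (f a t) < e"
    using d1 d2 by (intro exI[of _ "min d1 d2"]) auto
qed

text \<open>\<open>A\<close> is the spatial Jacobian matrix of \<open>W\<close>. Solutions are only considered on \<open>[0, T]\<close>, hence the
  one-sided derivatives at the end points.\<close>

locale lipschitz_flow =
  fixes W :: "real \<Rightarrow> real^'n \<Rightarrow> real^'n"
    and A :: "real \<Rightarrow> real^'n \<Rightarrow> real^'n^'n"
    and L T :: real
  assumes T: "0 \<le> T"
    and W_der: "\<And>t x. (W t has_derivative (\<lambda>h. A t x *v h)) (at x)"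
    and W_cont: "continuous_on UNIV (\<lambda>(t, x). W t x)"
    and A_cont: "continuous_on UNIV (\<lambda>(t, x). A t x)"
    and A_le: "\<And>t x. norm (A t x) \<le> L"
begin

lemma L: "0 \<le> L"
  using A_le[of 0 0] norm_ge_zero order_trans by blast

lemma A_v_le: "norm (A t x *v h) \<le> L * norm h"
  using norm_matrix_vector_le[of "A t x" h] mult_right_mono[OF A_le[of t x], of "norm h"] by simp

lemma W_lipschitz: "norm (W t x - W t y) \<le> L * norm (x - y)"
  by (rule differentiable_bound[of UNIV "W t" "\<lambda>x h. A t x *v h"])
    (auto intro!: W_der onorm_bound L A_v_le)

lemma flow_exists:
  "\<exists>X. X 0 = a \<and> (\<forall>t\<in>{0..T}. (X has_vector_derivative W t (X t)) (at t within {0..T}))"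
  by (rule picard_global[OF T continuous_on_subset[OF W_cont subset_UNIV] W_lipschitz, of a]) blast

definition X :: "real^'n \<Rightarrow> real \<Rightarrow> real^'n"
  where "X a = (SOME X. X 0 = a \<and>
    (\<forall>t\<in>{0..T}. (X has_vector_derivative W t (X t)) (at t within {0..T})))"

lemma X_0 [simp]: "X a 0 = a"
  and X_der: "t \<in> {0..T} \<Longrightarrow> (X a has_vector_derivative W t (X a t)) (at t within {0..T})"
  using someI_ex[OF flow_exists[of a], folded X_def] by blast+

lemma X_cont_time: "continuous_on {0..T} (X a)"
  using X_der by (intro has_vector_derivative_imp_continuous_on)

lemma A_along_cont: "continuous_on {0..T} (\<lambda>t. A t (X a t))"
  using continuous_on_compose2[OF A_cont continuous_on_Pair[OF continuous_on_id X_cont_time]]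
  by simp

lemma tangent_exists:
  "\<exists>z. z 0 = v \<and> (\<forall>t\<in>{0..T}. (z has_vector_derivative A t (X a t) *v z t) (at t within {0..T}))"
proof (rule picard_global[OF T, of "\<lambda>t z. A t (X a t) *v z" L v])
  have "continuous_on ({0..T} \<times> UNIV) (\<lambda>x. A (fst x) (X a (fst x)))"
    by (rule continuous_on_compose2[OF A_along_cont continuous_on_fst[OF continuous_on_id]]) auto
  then show "continuous_on ({0..T} \<times> UNIV) (\<lambda>(t, z). A t (X a t) *v z)"
    unfolding split_beta by (intro continuous_intros)
  show "norm (A t (X a t) *v x - A t (X a t) *v y) \<le> L * norm (x - y)" for t x y
    unfolding matrix_vector_mult_diff_distrib[symmetric] by (rule A_v_le)
qed blast

text \<open>Solution of the equation linearised along the trajectory of \<open>a\<close>. It is constructed directly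
  and only afterwards, in \<open>X_has_derivative\<close>, recognised as the derivative of the flow in
  direction \<open>v\<close>.\<close>

definition tangent :: "real^'n \<Rightarrow> real^'n \<Rightarrow> real \<Rightarrow> real^'n"
  where "tangent a v = (SOME z. z 0 = v \<and>
    (\<forall>t\<in>{0..T}. (z has_vector_derivative A t (X a t) *v z t) (at t within {0..T})))"

lemma tangent_0: "tangent a v 0 = v"
  and tangent_der: "t \<in> {0..T} \<Longrightarrow>
    (tangent a v has_vector_derivative A t (X a t) *v tangent a v t) (at t within {0..T})"
  using someI_ex[OF tangent_exists[of v a], folded tangent_def] by blast+

definition Y :: "real^'n \<Rightarrow> real \<Rightarrow> real^'n^'n"
  where "Y a t = (\<chi> i j. tangent a (axis j 1) t $ i)"

lemma Y_v: "Y a t *v v = (\<Sum>j\<in>UNIV. v $ j *\<^sub>R tangent a (axis j 1) t)"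
  by (simp add: Y_def vec_eq_iff matrix_vector_mult_def sum_component mult.commute)

lemma Y_0 [simp]: "Y a 0 = mat 1"
  by (simp add: Y_def tangent_0 vec_eq_iff mat_def axis_def)

lemma Y_der: "t \<in> {0..T} \<Longrightarrow>
    ((\<lambda>t. Y a t *v v) has_vector_derivative A t (X a t) *v (Y a t *v v)) (at t within {0..T})"
  using has_vector_derivative_sum[of UNIV "\<lambda>j t. v $ j *\<^sub>R tangent a (axis j 1) t", OF
      bounded_linear.has_vector_derivative[OF bounded_linear_scaleR_right tangent_der]]
  by (simp add: Y_v linear_sum[OF matrix_vector_mul_linear] matrix_vector_mult_scaleR)

lemma Y_cont_time: "continuous_on {0..T} (\<lambda>t. Y a t *v v)"
  using Y_der by (intro has_vector_derivative_imp_continuous_on)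

abbreviation "C \<equiv> growth L T"

lemma C_nonneg: "0 \<le> C"
  by (rule growth_nonneg[OF T])

lemma X_lipschitz: "t \<in> {0..T} \<Longrightarrow> norm (X b t - X a t) \<le> C * norm (b - a)"
  using gronwall_norm[of T "\<lambda>t. X b t - X a t" "\<lambda>t. W t (X b t) - W t (X a t)" L 0 t]
  by (simp add: has_vector_derivative_diff X_der W_lipschitz L)

lemma Y_le: "t \<in> {0..T} \<Longrightarrow> norm (Y a t *v v) \<le> C * norm v"
  using gronwall_norm[of T "\<lambda>t. Y a t *v v" "\<lambda>t. A t (X a t) *v (Y a t *v v)" L 0 t]
  by (simp add: Y_der A_v_le L)

lemma X_inj:
  assumes "t \<in> {0..T}" "X a t = X b t"
  shows "a = b"
proof -
  have "exp ((- 2 * L) * t) * (norm (X a 0 - X b 0))\<^sup>2 \<le> (norm (X a t - X b t))\<^sup>2"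
  proof (rule exponential_lower_comparison[OF norm_square_has_derivative
        [OF has_vector_derivative_diff[OF X_der X_der]]])
    fix r
    have "- ((X a r - X b r) \<bullet> (W r (X a r) - W r (X b r)))
        \<le> norm (X a r - X b r) * norm (W r (X a r) - W r (X b r))"
      using Cauchy_Schwarz_ineq2[of "X a r - X b r" "W r (X a r) - W r (X b r)"] by linarith
    also have "\<dots> \<le> norm (X a r - X b r) * (L * norm (X a r - X b r))"
      by (intro mult_left_mono W_lipschitz) auto
    finally show "(- 2 * L) * (norm (X a r - X b r))\<^sup>2
        \<le> 2 * ((X a r - X b r) \<bullet> (W r (X a r) - W r (X b r)))"
      by (simp add: power2_eq_square algebra_simps)
  qed (use assms in auto)
  then show ?thesis using assms by (simp add: mult_le_0_iff)
qed

text \<open>Uniform continuity of \<open>A\<close> near the compact trajectory of \<open>a\<close>, which makes the Taylor remainders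
  of \<open>W\<close> along that trajectory small uniformly in time.\<close>

lemma A_near:
  assumes "e > 0"
  obtains d where "d > 0"
    "\<And>t x h. t \<in> {0..T} \<Longrightarrow> norm (x - X a t) \<le> d \<Longrightarrow>
      norm ((A t x - A t (X a t)) *v h) \<le> e * norm h"
proof -
  have "bounded (X a ` {0..T})"
    by (intro compact_imp_bounded compact_continuous_image X_cont_time) auto
  then obtain M where "\<forall>x\<in>X a ` {0..T}. norm x \<le> M"
    unfolding bounded_iff by blast
  then have M: "norm (X a t) \<le> M" if "t \<in> {0..T}" for t
    using that by blast
  let ?K = "{0..T} \<times> cball 0 (M + 1)"
  have "uniformly_continuous_on ?K (\<lambda>(t, x). A t x)"
    by (intro compact_uniformly_continuous continuous_on_subset[OF A_cont] compact_Times) auto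
  then obtain d where d: "d > 0"
    "\<And>p p'. p \<in> ?K \<Longrightarrow> p' \<in> ?K \<Longrightarrow> dist p' p < d \<Longrightarrow>
      dist (case p' of (t, x) \<Rightarrow> A t x) (case p of (t, x) \<Rightarrow> A t x) < e"
    unfolding uniformly_continuous_on_def using assms by metis
  show ?thesis
  proof
    show "min (d / 2) 1 > 0" using d by simp
    fix t x h assume t: "t \<in> {0..T}" and x: "norm (x - X a t) \<le> min (d / 2) 1"
    have "norm x \<le> norm (X a t) + norm (x - X a t)" by norm
    then have "norm x \<le> M + 1" using M[OF t] x by simp
    moreover have "norm (X a t) \<le> M + 1" using M[OF t] by simp
    ultimately have "dist (A t x) (A t (X a t)) < e"
      using d(2)[of "(t, X a t)" "(t, x)"] t x d(1) by (simp add: dist_Pair_Pair dist_norm)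
    then have "norm (A t x - A t (X a t)) \<le> e" by (simp add: dist_norm)
    then show "norm ((A t x - A t (X a t)) *v h) \<le> e * norm h"
      by (intro order_trans[OF norm_matrix_vector_le] mult_right_mono) auto
  qed
qed

text \<open>The error \<open>X b - X a - Y (b - a)\<close> starts at zero and solves the linearised equation up to a
  Taylor remainder of \<open>W\<close>, which is \<open>o(|b - a|)\<close> uniformly in time because the trajectories stay
  within distance \<open>C |b - a|\<close> of each other; Gronwall concludes.\<close>

theorem X_has_derivative:
  assumes t: "t \<in> {0..T}"
  shows "((\<lambda>a. X a t) has_derivative (\<lambda>h. Y a t *v h)) (at a)"
  unfolding has_derivative_at_alt
proof (intro conjI allI impI)
  show "bounded_linear ((*v) (Y a t))" by (rule matrix_vector_mul_bounded_linear)
  fix e :: real assume e: "e > 0"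
  obtain e' where e': "0 < e'" "C * C * e' < e"
    using small_factor[of "C * C" e] C_nonneg e by auto
  obtain d where d: "d > 0" "\<And>t x h. t \<in> {0..T} \<Longrightarrow> norm (x - X a t) \<le> d \<Longrightarrow>
      norm ((A t x - A t (X a t)) *v h) \<le> e' * norm h"
    using A_near[OF e'(1), of a] by metis
  obtain r0 where r0: "0 < r0" "C * r0 < d"
    using small_factor[OF C_nonneg d(1)] by auto
  have "norm (X b t - X a t - Y a t *v (b - a)) \<le> e * norm (b - a)"
    if b: "norm (b - a) < r0" for b
  proof -
    have Xd: "norm (X b r - X a r) \<le> d" if "r \<in> {0..T}" for r
    proof -
      have "norm (X b r - X a r) \<le> C * norm (b - a)" by (rule X_lipschitz[OF that])
      also have "\<dots> \<le> C * r0" using b C_nonneg by (intro mult_left_mono) auto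
      finally show ?thesis using r0 by simp
    qed
    let ?z = "\<lambda>r. X b r - X a r - Y a r *v (b - a)"
    let ?z' = "\<lambda>r. W r (X b r) - W r (X a r) - A r (X a r) *v (Y a r *v (b - a))"
    have "norm (?z t) \<le> C * (norm (?z 0) + norm (b - a) * (C * e'))"
    proof (rule gronwall_norm[of T ?z ?z'])
      fix r assume r: "r \<in> {0..T}"
      show "(?z has_vector_derivative ?z' r) (at r within {0..T})"
        by (intro has_vector_derivative_diff X_der Y_der r)
      have "norm (W r (X b r) - W r (X a r) - A r (X a r) *v (X b r - X a r))
          \<le> norm (X b r - X a r) * e'"
      proof (rule differentiable_bound_linearization[of "X a r" "X b r" "cball (X a r) d" "W r"
            "\<lambda>x. (*v) (A r x)" "X a r" e'])
        fix s :: real assume "s \<in> {0..1}"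
        then have "norm (s *\<^sub>R (X b r - X a r)) \<le> norm (X b r - X a r)"
          by (simp add: mult_left_le_one_le)
        then show "X a r + s *\<^sub>R (X b r - X a r) \<in> cball (X a r) d"
          using Xd[OF r] by (simp add: dist_norm)
      next
        fix x assume "x \<in> cball (X a r) d"
        then have "norm (x - X a r) \<le> d" by (simp add: dist_norm norm_minus_commute)
        then show "onorm ((*v) (A r x) - (*v) (A r (X a r))) \<le> e'"
          using d(2)[OF r] e'(1)
          by (intro onorm_bound) (auto simp: matrix_vector_mult_diff_rdistrib)
      qed (use d(1) in \<open>auto intro: has_derivative_at_withinI W_der\<close>)
      also have "\<dots> \<le> (C * norm (b - a)) * e'"
        using e'(1) by (intro mult_right_mono X_lipschitz r) auto
      finally have "norm (W r (X b r) - W r (X a r) - A r (X a r) *v (X b r - X a r))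
          \<le> norm (b - a) * (C * e')" by (simp add: mult_ac)
      moreover have "?z' r = A r (X a r) *v ?z r
          + (W r (X b r) - W r (X a r) - A r (X a r) *v (X b r - X a r))"
        by (simp add: matrix_vector_mult_diff_distrib)
      ultimately show "norm (?z' r) \<le> L * norm (?z r) + norm (b - a) * (C * e')"
        using A_v_le[of r "X a r" "?z r"]
        by (metis (no_types, lifting) add_mono norm_triangle_le)
    qed (use L C_nonneg e'(1) t in auto)
    also have "\<dots> = C * C * e' * norm (b - a)" by simp
    also have "\<dots> \<le> e * norm (b - a)" by (intro mult_right_mono less_imp_le[OF e'(2)]) auto
    finally show ?thesis .
  qed
  with r0(1) show "\<exists>d>0. \<forall>b. norm (b - a) < d \<longrightarrow>
      norm (X b t - X a t - Y a t *v (b - a)) \<le> e * norm (b - a)" by blast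
qed

lemma X_cont: "continuous_on (UNIV \<times> {0..T}) (\<lambda>(a, t). X a t)"
proof (rule continuous_on_Times_uniformly[OF X_cont_time])
  fix a and e :: real assume e: "e > 0"
  obtain r0 where r0: "0 < r0" "C * r0 < e"
    using small_factor[OF C_nonneg e] by auto
  have "dist (X b t) (X a t) < e" if "dist b a < r0" "t \<in> {0..T}" for b t
  proof -
    have "dist (X b t) (X a t) \<le> C * dist b a"
      using X_lipschitz[OF that(2)] by (simp add: dist_norm)
    also have "\<dots> \<le> C * r0" using that C_nonneg by (intro mult_left_mono) auto
    finally show ?thesis using r0 by simp
  qed
  then show "\<exists>d>0. \<forall>b t. dist b a < d \<longrightarrow> t \<in> {0..T} \<longrightarrow> dist (X b t) (X a t) < e"
    using r0(1) by blast
qed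

lemma Y_v_cont: "continuous_on (UNIV \<times> {0..T}) (\<lambda>(a, t). Y a t *v v)"
proof (rule continuous_on_Times_uniformly[OF Y_cont_time])
  fix a and e :: real assume e: "e > 0"
  obtain e' where e': "0 < e'" "C * C * norm v * e' < e"
    using small_factor[of "C * C * norm v" e] C_nonneg e by auto
  obtain d where d: "d > 0" "\<And>t x h. t \<in> {0..T} \<Longrightarrow> norm (x - X a t) \<le> d \<Longrightarrow>
      norm ((A t x - A t (X a t)) *v h) \<le> e' * norm h"
    using A_near[OF e'(1), of a] by metis
  obtain r0 where r0: "0 < r0" "C * r0 < d"
    using small_factor[OF C_nonneg d(1)] by auto
  have "dist (Y b t *v v) (Y a t *v v) < e"
    if b: "norm (b - a) < r0" and t: "t \<in> {0..T}" for b t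
  proof -
    have Xd: "norm (X b r - X a r) \<le> d" if "r \<in> {0..T}" for r
    proof -
      have "norm (X b r - X a r) \<le> C * norm (b - a)" by (rule X_lipschitz[OF that])
      also have "\<dots> \<le> C * r0" using b C_nonneg by (intro mult_left_mono) auto
      finally show ?thesis using r0 by simp
    qed
    let ?z = "\<lambda>r. Y b r *v v - Y a r *v v"
    let ?z' = "\<lambda>r. A r (X b r) *v (Y b r *v v) - A r (X a r) *v (Y a r *v v)"
    have "norm (?z t) \<le> C * (norm (?z 0) + e' * (C * norm v))"
    proof (rule gronwall_norm[of T ?z ?z'])
      fix r assume r: "r \<in> {0..T}"
      show "(?z has_vector_derivative ?z' r) (at r within {0..T})"
        by (intro has_vector_derivative_diff Y_der r)
      have "norm ((A r (X b r) - A r (X a r)) *v (Y a r *v v)) \<le> e' * norm (Y a r *v v)"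
        by (rule d(2)[OF r Xd[OF r]])
      also have "\<dots> \<le> e' * (C * norm v)"
        using e'(1) by (intro mult_left_mono Y_le r) auto
      finally have "norm ((A r (X b r) - A r (X a r)) *v (Y a r *v v)) \<le> e' * (C * norm v)" .
      moreover have "?z' r = A r (X b r) *v ?z r + (A r (X b r) - A r (X a r)) *v (Y a r *v v)"
        by (simp add: matrix_vector_mult_diff_distrib matrix_vector_mult_diff_rdistrib)
      ultimately show "norm (?z' r) \<le> L * norm (?z r) + e' * (C * norm v)"
        using A_v_le[of r "X b r" "?z r"]
        by (metis (no_types, lifting) add_mono norm_triangle_le)
    qed (use L C_nonneg e'(1) t in auto)
    also have "\<dots> = C * C * norm v * e'" by simp
    also have "\<dots> < e" by (rule e')
    finally show ?thesis by (simp add: dist_norm)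
  qed
  with r0(1) show "\<exists>d>0. \<forall>b t. dist b a < d \<longrightarrow> t \<in> {0..T} \<longrightarrow>
      dist (Y b t *v v) (Y a t *v v) < e" unfolding dist_norm[of _ a] by blast
qed

lemma Y_cont: "continuous_on (UNIV \<times> {0..T}) (\<lambda>(a, t). Y a t)"
proof -
  have "continuous_on (UNIV \<times> {0..T}) (\<lambda>p. (Y (fst p) (snd p) *v axis j 1) $ i)" for i j
    using Y_v_cont[of "axis j 1"] by (intro continuous_on_component) (simp add: split_beta)
  then have "continuous_on (UNIV \<times> {0..T}) (\<lambda>p. \<chi> i j. Y (fst p) (snd p) $ i $ j)"
    by (intro continuous_on_vec_lambda) (simp add: matrix_vector_mult_basis column_def)
  then show ?thesis by (simp add: split_beta)
qed

end

text \<open>Liouville's formula: \<open>det M\<close> solves \<open>u' = trace A u\<close>, by expanding the determinant and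
  differentiating entry by entry.\<close>

theorem liouville_det:
  fixes M A :: "real \<Rightarrow> real^3^3"
  assumes der: "\<And>t v. t \<in> {0..T} \<Longrightarrow>
      ((\<lambda>t. M t *v v) has_vector_derivative A t *v (M t *v v)) (at t within {0..T})"
    and tr: "\<And>t. t \<in> {0..T} \<Longrightarrow> trace (A t) = c"
    and t: "t \<in> {0..T}"
  shows "det (M t) = exp (c * t) * det (M 0)"
proof -
  have entry: "((\<lambda>t. M t $ i $ j) has_vector_derivative (A t ** M t) $ i $ j) (at t within {0..T})"
    if "t \<in> {0..T}" for t i j
  proof -
    have "((\<lambda>t. (M t *v axis j 1) $ i) has_vector_derivative (A t *v (M t *v axis j 1)) $ i)
        (at t within {0..T})"
      using bounded_linear.has_vector_derivative[OF bounded_linear_vec_nth der[OF that]] .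
    then show ?thesis
      by (simp add: matrix_vector_mult_basis column_def)
        (simp add: matrix_vector_mult_def matrix_matrix_mult_def)
  qed
  have der: "((\<lambda>t. det (M t)) has_vector_derivative c * det (M t)) (at t within {0..T})"
    if "t \<in> {0..T}" for t
  proof -
    note e = entry[OF that, folded has_real_derivative_iff_has_vector_derivative]
    show ?thesis
      unfolding has_real_derivative_iff_has_vector_derivative[symmetric] det_3 tr[OF that, symmetric]
      by (rule DERIV_cong, (rule DERIV_add DERIV_diff DERIV_mult e)+)
        (simp add: trace_def matrix_matrix_mult_def sum_3 algebra_simps)
  qed
  have "exp (c * t) * det (M 0) \<le> det (M t)"
    by (rule exponential_lower_comparison[OF der _ t]) auto
  moreover have "det (M t) \<le> exp (c * t) * (det (M 0) + 0 * t)"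
    by (rule exponential_comparison[OF der _ t]) auto
  ultimately show ?thesis by simp
qed

section \<open>Circulation around small loops\<close>

lemma difference_quotient_tendsto:
  fixes f :: "'a::real_normed_vector \<Rightarrow> 'b::real_normed_vector" and \<epsilon> :: "nat \<Rightarrow> real"
  assumes f: "(f has_derivative f') (at a)"
    and \<epsilon>: "\<epsilon> \<longlonglongrightarrow> 0" "\<And>k. \<epsilon> k \<noteq> 0"
  shows "(\<lambda>k. (f (a + \<epsilon> k *\<^sub>R w) - f a) /\<^sub>R \<epsilon> k) \<longlonglongrightarrow> f' w"
proof -
  interpret bounded_linear f' using f by (rule has_derivative_bounded_linear)
  have "((\<lambda>s. f (a + s *\<^sub>R w)) has_derivative (\<lambda>s. f' (s *\<^sub>R w))) (at 0)"
    by (rule has_derivative_compose[of "\<lambda>s. a + s *\<^sub>R w" "\<lambda>s. s *\<^sub>R w" 0 UNIV f f'])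
      (use f in \<open>auto intro!: derivative_eq_intros\<close>)
  then have "(\<lambda>h. norm (f (a + h *\<^sub>R w) - f a - h *\<^sub>R f' w) / norm h) \<midarrow>0\<rightarrow> 0"
    by (simp add: has_derivative_at scaleR)
  moreover have "filterlim \<epsilon> (at 0) sequentially"
    using \<epsilon> by (auto simp: filterlim_at)
  ultimately have "(\<lambda>k. norm (f (a + \<epsilon> k *\<^sub>R w) - f a - \<epsilon> k *\<^sub>R f' w) / norm (\<epsilon> k)) \<longlonglongrightarrow> 0"
    by (rule filterlim_compose)
  moreover have "norm (f (a + \<epsilon> k *\<^sub>R w) - f a - \<epsilon> k *\<^sub>R f' w) / norm (\<epsilon> k)
      = norm ((f (a + \<epsilon> k *\<^sub>R w) - f a) /\<^sub>R \<epsilon> k - f' w)" for k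
  proof -
    have "(f (a + \<epsilon> k *\<^sub>R w) - f a) /\<^sub>R \<epsilon> k - f' w
        = (f (a + \<epsilon> k *\<^sub>R w) - f a - \<epsilon> k *\<^sub>R f' w) /\<^sub>R \<epsilon> k"
      using \<epsilon>(2)[of k] by (simp add: scaleR_diff_right)
    then show ?thesis by (simp add: divide_inverse_commute)
  qed
  ultimately have "(\<lambda>k. norm ((f (a + \<epsilon> k *\<^sub>R w) - f a) /\<^sub>R \<epsilon> k - f' w)) \<longlonglongrightarrow> 0" by simp
  then show ?thesis by (simp add: tendsto_norm_zero_iff LIM_zero_iff)
qed

text \<open>Ellipses as test loops: they are smooth and closed, so one fundamental theorem of calculus
  suffices, and as \<open>u\<close>, \<open>v\<close> vary they detect every component of a 2-form.\<close>

definition circle :: "'a::real_vector \<Rightarrow> 'a \<Rightarrow> real \<Rightarrow> 'a"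
  where "circle u v \<theta> = cos \<theta> *\<^sub>R u + sin \<theta> *\<^sub>R v"

definition circle' :: "'a::real_vector \<Rightarrow> 'a \<Rightarrow> real \<Rightarrow> 'a"
  where "circle' u v \<theta> = cos \<theta> *\<^sub>R v - sin \<theta> *\<^sub>R u"

lemma circle_der: "(circle u v has_vector_derivative circle' u v \<theta>) (at \<theta> within S)"
proof -
  have "(cos has_vector_derivative - sin \<theta>) (at \<theta> within S)"
    "(sin has_vector_derivative cos \<theta>) (at \<theta> within S)"
    by (simp_all add: has_real_derivative_iff_has_vector_derivative[symmetric]
        DERIV_cos DERIV_sin has_field_derivative_at_within)
  note this[THEN bounded_linear.has_vector_derivative[OF bounded_linear_scaleR_left]]
  from has_vector_derivative_add[OF this] show ?thesis
    unfolding circle_def[abs_def] circle'_def by (simp only: scaleR_minus_left add.commute diff_conv_add_uminus)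
qed

lemma circle_cont: "continuous_on S (circle u v)" "continuous_on S (circle' u v)"
  for u :: "'a::real_normed_vector"
  unfolding circle_def[abs_def] circle'_def[abs_def] by (intro continuous_intros)+

lemma circle_closed: "circle u v 0 = circle u v (2 * pi)"
  by (simp add: circle_def)

lemma norm_circle_le:
  fixes u :: "'a::real_normed_vector"
  shows "norm (circle u v \<theta>) \<le> norm u + norm v" "norm (circle' u v \<theta>) \<le> norm u + norm v"
proof -
  have "norm (cos \<theta> *\<^sub>R u) \<le> norm u" "norm (sin \<theta> *\<^sub>R v) \<le> norm v"
    "norm (cos \<theta> *\<^sub>R v) \<le> norm v" "norm (sin \<theta> *\<^sub>R u) \<le> norm u"
    by (simp_all add: mult_left_le_one_le)
  then show "norm (circle u v \<theta>) \<le> norm u + norm v" "norm (circle' u v \<theta>) \<le> norm u + norm v"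
    unfolding circle_def circle'_def
    by (intro norm_triangle_le norm_triangle_le_diff; linarith)+
qed

text \<open>Only \<open>cos\<^sup>2\<close> and \<open>sin\<^sup>2\<close>, with mean \<open>1/2\<close>, survive the integration; the mixed terms integrate to
  zero. What remains is the antisymmetric part, \<open>\<pi>\<close> being the area of the unit disc.\<close>

lemma circle_area_integral:
  fixes D E :: "'a::real_vector \<Rightarrow> 'b::real_inner"
  assumes "linear D" "linear E"
  shows "((\<lambda>\<theta>. D (circle u v \<theta>) \<bullet> E (circle' u v \<theta>)) has_integral
    pi * (D u \<bullet> E v - D v \<bullet> E u)) {0..2 * pi}"
proof -
  interpret D: linear D by fact
  interpret E: linear E by fact
  define F where "F \<theta> = (\<theta> + sin \<theta> * cos \<theta>) / 2 * (D u \<bullet> E v)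
      - (\<theta> - sin \<theta> * cos \<theta>) / 2 * (D v \<bullet> E u)
      + (sin \<theta>)\<^sup>2 / 2 * (D v \<bullet> E v - D u \<bullet> E u)" for \<theta> :: real
  have "((\<lambda>\<theta>. D (circle u v \<theta>) \<bullet> E (circle' u v \<theta>)) has_integral F (2 * pi) - F 0) {0..2 * pi}"
  proof (rule fundamental_theorem_of_calculus)
    fix \<theta> :: real
    have sq: "sin \<theta> * sin \<theta> = 1 - cos \<theta> * cos \<theta>"
      using sin_squared_eq[of \<theta>] by (simp add: power2_eq_square)
    then have sq': "sin \<theta> * (sin \<theta> * x) = x - cos \<theta> * (cos \<theta> * x)" for x
      by (simp add: mult.assoc[symmetric] left_diff_distrib)
    have "(F has_real_derivative D (circle u v \<theta>) \<bullet> E (circle' u v \<theta>)) (at \<theta>)"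
      unfolding F_def
      by (rule derivative_eq_intros refl | simp)+
        (simp add: circle_def circle'_def D.add D.scale E.diff E.scale inner_simps
          sq sq' power2_eq_square field_simps)
    then show "(F has_vector_derivative D (circle u v \<theta>) \<bullet> E (circle' u v \<theta>))
        (at \<theta> within {0..2 * pi})"
      by (simp add: has_real_derivative_iff_has_vector_derivative[symmetric]
          has_field_derivative_at_within)
  qed simp
  also have "F (2 * pi) - F 0 = pi * (D u \<bullet> E v - D v \<bullet> E u)"
    by (simp add: F_def algebra_simps)
  finally show ?thesis .
qed

text \<open>The circulation of the 1-form \<open>f \<bullet> dg\<close> around a loop of size \<open>\<epsilon>\<close>, divided by \<open>\<epsilon>\<^sup>2\<close>, tends to \<open>\<pi>\<close> times
  its exterior derivative at the centre. No second derivative of \<open>g\<close> is involved, unlike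
  in Stokes' theorem: the constant \<open>f a\<close> contributes zero because \<open>g\<close> is single-valued on the closed
  loop, so \<open>f\<close> may be replaced by its difference quotient. One of the two factors \<open>\<epsilon>\<close> is already
  cancelled here, since \<open>circle'\<close> is the velocity of the unscaled loop.\<close>

theorem circulation_density:
  fixes f g :: "real^'n \<Rightarrow> real^'m" and G :: "real^'n \<Rightarrow> real^'n^'m" and \<epsilon> :: "nat \<Rightarrow> real"
  assumes f: "(f has_derivative f') (at a)"
    and lip: "\<And>x y. norm (f x - f y) \<le> K * norm (x - y)"
    and g: "\<And>x. (g has_derivative (\<lambda>h. G x *v h)) (at x)"
    and G: "continuous_on UNIV G"
    and \<epsilon>: "\<epsilon> \<longlonglongrightarrow> 0" "\<And>k. 0 < \<epsilon> k" "\<And>k. \<epsilon> k \<le> 1"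
  shows "(\<lambda>k. integral {0..2 * pi} (\<lambda>\<theta>. f (a + \<epsilon> k *\<^sub>R circle u v \<theta>) \<bullet>
      (G (a + \<epsilon> k *\<^sub>R circle u v \<theta>) *v circle' u v \<theta>)) / \<epsilon> k)
    \<longlonglongrightarrow> pi * (f' u \<bullet> (G a *v v) - f' v \<bullet> (G a *v u))"
proof -
  let ?c = "circle u v" and ?c' = "circle' u v"
  let ?p = "\<lambda>k \<theta>. a + \<epsilon> k *\<^sub>R ?c \<theta>"
  let ?R = "norm u + norm v"
  have fcont: "continuous_on UNIV f"
  proof (rule lipschitz_on_continuous_on)
    show "\<bar>K\<bar>-lipschitz_on UNIV f"
      by (rule lipschitz_onI)
        (use lip in \<open>auto simp: dist_norm intro!: order_trans[OF lip] mult_right_mono\<close>)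
  qed
  have pcont: "continuous_on S (?p k)" for S k
    by (intro continuous_intros circle_cont)
  have fp: "continuous_on S (\<lambda>\<theta>. f (?p k \<theta>))" and Gp: "continuous_on S (\<lambda>\<theta>. G (?p k \<theta>))" for S k
    by (rule continuous_on_compose2[OF fcont pcont] continuous_on_compose2[OF G pcont], simp)+
  have closed: "((\<lambda>\<theta>. f a \<bullet> (G (?p k \<theta>) *v ?c' \<theta>) / \<epsilon> k) has_integral 0) {0..2 * pi}" for k
  proof -
    have cancel: "\<epsilon> k * (inverse (\<epsilon> k) * x) = x" for x
      using \<epsilon>(2)[of k] by (simp add: mult.assoc[symmetric])
    have "((\<lambda>\<theta>. f a \<bullet> (G (?p k \<theta>) *v ?c' \<theta>) / \<epsilon> k) has_integral
        f a \<bullet> g (?p k (2 * pi)) / (\<epsilon> k)\<^sup>2 - f a \<bullet> g (?p k 0) / (\<epsilon> k)\<^sup>2) {0..2 * pi}"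
    proof (rule fundamental_theorem_of_calculus)
      fix \<theta> :: real
      have "(?p k has_vector_derivative \<epsilon> k *\<^sub>R ?c' \<theta>) (at \<theta> within {0..2 * pi})"
        using has_vector_derivative_add[OF has_vector_derivative_const[of a]
            bounded_linear.has_vector_derivative[OF bounded_linear_scaleR_right circle_der]] by simp
      from vector_derivative_diff_chain_within[OF this has_derivative_at_withinI[OF g]]
      have "((\<lambda>\<theta>. g (?p k \<theta>)) has_vector_derivative G (?p k \<theta>) *v (\<epsilon> k *\<^sub>R ?c' \<theta>))
          (at \<theta> within {0..2 * pi})" by (simp add: o_def)
      from bounded_linear.has_vector_derivative[OF bounded_linear_inner_right[of "f a /\<^sub>R (\<epsilon> k)\<^sup>2"] this]
      show "((\<lambda>\<theta>. f a \<bullet> g (?p k \<theta>) / (\<epsilon> k)\<^sup>2) has_vector_derivative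
          f a \<bullet> (G (?p k \<theta>) *v ?c' \<theta>) / \<epsilon> k) (at \<theta> within {0..2 * pi})"
        using cancel by (simp add: matrix_vector_mult_scaleR divide_inverse mult_ac power2_eq_square)
    qed simp
    then show ?thesis by (simp add: circle_closed)
  qed
  let ?h = "\<lambda>k \<theta>. ((f (?p k \<theta>) - f a) /\<^sub>R \<epsilon> k) \<bullet> (G (?p k \<theta>) *v ?c' \<theta>)"
  have hint: "?h k integrable_on {0..2 * pi}" for k
    by (intro integrable_continuous_real continuous_intros fp Gp circle_cont)
  have eq: "integral {0..2 * pi} (\<lambda>\<theta>. f (?p k \<theta>) \<bullet> (G (?p k \<theta>) *v ?c' \<theta>)) / \<epsilon> k
      = integral {0..2 * pi} (?h k)" for k
  proof -
    have "((\<lambda>\<theta>. ?h k \<theta> + f a \<bullet> (G (?p k \<theta>) *v ?c' \<theta>) / \<epsilon> k)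
        has_integral integral {0..2 * pi} (?h k) + 0) {0..2 * pi}"
      by (rule has_integral_add[OF integrable_integral[OF hint] closed])
    then have "((\<lambda>\<theta>. f (?p k \<theta>) \<bullet> (G (?p k \<theta>) *v ?c' \<theta>) / \<epsilon> k)
        has_integral integral {0..2 * pi} (?h k)) {0..2 * pi}"
      by (simp add: inner_diff_left divide_inverse_commute right_diff_distrib)
    from integral_unique[OF this] show ?thesis by simp
  qed
  have "bounded (G ` cball a ?R)"
    by (intro compact_imp_bounded compact_continuous_image continuous_on_subset[OF G]) auto
  then obtain B where "\<forall>M\<in>G ` cball a ?R. norm M \<le> B" unfolding bounded_iff by blast
  then have B: "norm (G x) \<le> B" if "x \<in> cball a ?R" for x using that by blast
  have "(\<lambda>k. integral {0..2 * pi} (?h k))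
      \<longlonglongrightarrow> integral {0..2 * pi} (\<lambda>\<theta>. f' (?c \<theta>) \<bullet> (G a *v ?c' \<theta>))"
  proof (rule dominated_convergence(2)[where h = "\<lambda>_. (\<bar>K\<bar> * ?R) * (B * ?R)"])
    show "?h k integrable_on {0..2 * pi}" for k by (rule hint)
    show "(\<lambda>_. (\<bar>K\<bar> * ?R) * (B * ?R)) integrable_on {0..2 * pi}"
      by (rule integrable_const_ivl)
  next
    fix k \<theta>
    have "norm (f (?p k \<theta>) - f a) \<le> \<bar>K\<bar> * (\<epsilon> k * ?R)"
    proof -
      have "norm (f (?p k \<theta>) - f a) \<le> K * norm (\<epsilon> k *\<^sub>R ?c \<theta>)"
        using lip[of "?p k \<theta>" a] by simp
      also have "\<dots> \<le> \<bar>K\<bar> * norm (\<epsilon> k *\<^sub>R ?c \<theta>)" by (intro mult_right_mono) auto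
      also have "\<dots> \<le> \<bar>K\<bar> * (\<epsilon> k * ?R)"
        using \<epsilon>(2)[of k] by (auto intro!: mult_left_mono norm_circle_le)
      finally show ?thesis .
    qed
    then have 1: "norm ((f (?p k \<theta>) - f a) /\<^sub>R \<epsilon> k) \<le> \<bar>K\<bar> * ?R"
      using \<epsilon>(2)[of k] mult_left_mono[of _ _ "inverse (\<epsilon> k)"]
      by (simp add: pos_divide_le_eq divide_inverse_commute[symmetric] mult_ac)
    have "\<epsilon> k * norm (?c \<theta>) \<le> 1 * ?R"
      using \<epsilon>(2)[of k] \<epsilon>(3)[of k] by (intro mult_mono norm_circle_le) auto
    then have "?p k \<theta> \<in> cball a ?R" using \<epsilon>(2)[of k] by (simp add: dist_norm)
    then have "norm (G (?p k \<theta>)) \<le> B" by (rule B)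
    then have 2: "norm (G (?p k \<theta>) *v ?c' \<theta>) \<le> B * ?R"
      by (intro order_trans[OF norm_matrix_vector_le] mult_mono norm_circle_le)
        (auto intro: order_trans[OF norm_ge_zero])
    show "norm (?h k \<theta>) \<le> (\<bar>K\<bar> * ?R) * (B * ?R)"
      unfolding real_norm_def
      by (rule order_trans[OF Cauchy_Schwarz_ineq2 mult_mono[OF 1 2]]) auto
  next
    fix \<theta> :: real
    have "(\<lambda>k. (f (?p k \<theta>) - f a) /\<^sub>R \<epsilon> k) \<longlonglongrightarrow> f' (?c \<theta>)"
      by (rule difference_quotient_tendsto[OF f \<epsilon>(1)]) (use \<epsilon>(2) in \<open>simp add: less_imp_neq[symmetric]\<close>)
    moreover have "(\<lambda>k. ?p k \<theta>) \<longlonglongrightarrow> a + 0 *\<^sub>R ?c \<theta>"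
      by (intro tendsto_intros \<epsilon>(1))
    then have "(\<lambda>k. G (?p k \<theta>)) \<longlonglongrightarrow> G a"
      using G by (intro isCont_tendsto_compose[of a G]) (auto simp: continuous_on_eq_continuous_at)
    then have "(\<lambda>k. G (?p k \<theta>) *v ?c' \<theta>) \<longlonglongrightarrow> G a *v ?c' \<theta>"
      by (rule bounded_bilinear.tendsto[OF bounded_bilinear_matrix_vector _ tendsto_const])
    ultimately show "(\<lambda>k. ?h k \<theta>) \<longlonglongrightarrow> f' (?c \<theta>) \<bullet> (G a *v ?c' \<theta>)"
      by (rule tendsto_inner)
  qed
  also have "integral {0..2 * pi} (\<lambda>\<theta>. f' (?c \<theta>) \<bullet> (G a *v ?c' \<theta>))
      = pi * (f' u \<bullet> (G a *v v) - f' v \<bullet> (G a *v u))"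
    by (rule integral_unique[OF circle_area_integral[OF has_derivative_linear[OF f]]]) simp
  finally show ?thesis unfolding eq .
qed

section \<open>Kelvin's circulation theorem and Cauchy's vorticity formula\<close>

text \<open>For \<open>M\<close> the Jacobian matrix of a field, this is its curl.\<close>

definition axial_vector :: "real^3^3 \<Rightarrow> real^3"
  where "axial_vector M = vector [M$3$2 - M$2$3, M$1$3 - M$3$1, M$2$1 - M$1$2]"

lemma axial_vector_inner_cross:
  "axial_vector M \<bullet> cross3 u v = (M *v u) \<bullet> v - (M *v v) \<bullet> u"
  by (simp add: axial_vector_def cross3_def inner_vec_def sum_3 matrix_vector_mult_def algebra_simps)

text \<open>When \<open>M\<close> is invertible the vectors \<open>M u \<times> M v\<close> include all products of basis vectors, hence a basis.\<close>

lemma eq_if_inner_cross_eq: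
  fixes x y :: "real^3" and M :: "real^3^3"
  assumes "det M \<noteq> 0" and eq: "\<And>u v. x \<bullet> cross3 (M *v u) (M *v v) = y \<bullet> cross3 (M *v u) (M *v v)"
  shows "x = y"
proof -
  obtain N where N: "M ** N = mat 1"
    using assms(1) unfolding invertible_det_nz[symmetric] invertible_def by blast
  then have MN: "M *v (N *v p) = p" for p
    by (simp add: matrix_vector_mul_assoc)
  have "x \<bullet> cross3 p q = y \<bullet> cross3 p q" for p q
    using eq[of "N *v p" "N *v q"] by (simp add: MN)
  from this[of "axis 2 1" "axis 3 1"] this[of "axis 3 1" "axis 1 1"] this[of "axis 1 1" "axis 2 1"]
  show ?thesis
    by (simp add: vec_eq_iff forall_3 cross3_def inner_vec_def sum_3 axis_def)
qed

text \<open>The profile equations with the derivatives as explicit parameters: \<open>J\<close> is the Jacobian matrix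
  of \<open>V\<close> in space, \<open>Vt\<close> its time derivative and \<open>G\<close> the pressure gradient. The uniform bound on
  \<open>J\<close> makes the transporting field globally Lipschitz.\<close>

locale profile_solution =
  fixes V :: "real^3 \<Rightarrow> real \<Rightarrow> real^3" and J :: "real^3 \<Rightarrow> real \<Rightarrow> real^3^3"
    and Vt G :: "real^3 \<Rightarrow> real \<Rightarrow> real^3" and P :: "real^3 \<Rightarrow> real \<Rightarrow> real"
    and a b K :: real
  assumes V_der: "\<And>y s. ((\<lambda>(y, s). V y s) has_derivative (\<lambda>(h, r). J y s *v h + r *\<^sub>R Vt y s)) (at (y, s))"
    and J_cont: "continuous_on UNIV (\<lambda>(y, s). J y s)"
    and Vt_cont: "continuous_on UNIV (\<lambda>(y, s). Vt y s)"
    and J_le: "\<And>y s. norm (J y s) \<le> K"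
    and trace_J: "\<And>y s. trace (J y s) = 0"
    and P_grad: "\<And>y s. GDERIV (\<lambda>x. P x s) y :> G y s"
    and momentum: "\<And>y s. Vt y s + a *\<^sub>R V y s + b *\<^sub>R (J y s *v y) + J y s *v V y s = - G y s"
    and b_pos: "b > 0"
begin

lemma V_cont: "continuous_on UNIV (\<lambda>(y, s). V y s)"
  unfolding continuous_on_eq_continuous_at[OF open_UNIV]
  using has_derivative_continuous[OF V_der] by auto

lemma V_cont_comp:
  assumes "continuous_on S f" "continuous_on S g"
  shows "continuous_on S (\<lambda>x. V (f x) (g x))"
  using continuous_on_compose2[OF V_cont continuous_on_Pair[OF assms]] by simp

lemma J_cont_comp:
  assumes "continuous_on S f" "continuous_on S g"
  shows "continuous_on S (\<lambda>x. J (f x) (g x))"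
  using continuous_on_compose2[OF J_cont continuous_on_Pair[OF assms]] by simp

lemma Vt_cont_comp:
  assumes "continuous_on S f" "continuous_on S g"
  shows "continuous_on S (\<lambda>x. Vt (f x) (g x))"
  using continuous_on_compose2[OF Vt_cont continuous_on_Pair[OF assms]] by simp

lemma G_eq: "G y s = - (Vt y s + a *\<^sub>R V y s + b *\<^sub>R (J y s *v y) + J y s *v V y s)"
  using momentum[of y s] by simp

lemma V_space_der: "((\<lambda>y. V y s) has_derivative (\<lambda>h. J y s *v h)) (at y)"
proof -
  have "((\<lambda>y. (y, s)) has_derivative (\<lambda>h. (h, 0))) (at y)"
    by (auto intro!: derivative_eq_intros)
  from has_derivative_compose[OF this V_der] show ?thesis by simp
qed

lemma V_lipschitz: "norm (V x s - V y s) \<le> K * norm (x - y)"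
proof (rule differentiable_bound[of UNIV "\<lambda>y. V y s" "\<lambda>y h. J y s *v h"])
  show "onorm ((*v) (J x s)) \<le> K" for x
    by (intro onorm_bound order_trans[OF norm_matrix_vector_le] mult_right_mono J_le)
      (auto intro: order_trans[OF norm_ge_zero J_le])
qed (auto intro: V_space_der)

end

text \<open>The flow of the transporting field over the time interval \<open>[s, s + T]\<close>, with time counted from \<open>s\<close>.\<close>

locale profile_flow = profile_solution +
  fixes s T :: real
  assumes T_nonneg: "0 \<le> T"
begin

definition drift :: "real \<Rightarrow> real^3 \<Rightarrow> real^3"
  where "drift t y = V y (s + t) + b *\<^sub>R y"

definition drift_jacobian :: "real \<Rightarrow> real^3 \<Rightarrow> real^3^3"
  where "drift_jacobian t y = J y (s + t) + b *\<^sub>R mat 1"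

lemma drift_jacobian_v: "drift_jacobian t y *v h = J y (s + t) *v h + b *\<^sub>R h"
  by (simp add: drift_jacobian_def matrix_vector_mult_add_rdistrib scaleR_matrix_vector_assoc[symmetric])

sublocale lipschitz_flow drift drift_jacobian "K + norm (b *\<^sub>R (mat 1 :: real^3^3))" T
proof
  show "(drift t has_derivative (\<lambda>h. drift_jacobian t x *v h)) (at x)" for t x
    unfolding drift_def[abs_def] drift_jacobian_v
    by (intro has_derivative_add V_space_der has_derivative_scaleR_right has_derivative_ident)
  show "continuous_on UNIV (\<lambda>(t, y). drift t y)"
    unfolding split_beta drift_def by (intro continuous_intros V_cont_comp)
  show "continuous_on UNIV (\<lambda>(t, y). drift_jacobian t y)"
    unfolding split_beta drift_jacobian_def by (intro continuous_intros J_cont_comp)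
  show "norm (drift_jacobian t x) \<le> K + norm (b *\<^sub>R (mat 1 :: real^3^3))" for t x
    unfolding drift_jacobian_def by (rule norm_triangle_le) (use J_le in auto)
qed (rule T_nonneg)

text \<open>Along a trajectory the transport terms of the momentum equation combine to the total time
  derivative of \<open>V\<close>.\<close>

lemma V_along_der:
  assumes t: "t \<in> {0..T}"
  shows "((\<lambda>t. V (X c t) (s + t)) has_vector_derivative
    - (a *\<^sub>R V (X c t) (s + t)) - G (X c t) (s + t)) (at t within {0..T})"
proof -
  have "((\<lambda>t. (X c t, s + t)) has_vector_derivative (drift t (X c t), 1))
      (at t within {0..T})"
    by (intro has_vector_derivative_Pair X_der t)
      (auto intro!: derivative_eq_intros simp: has_real_derivative_iff_has_vector_derivative[symmetric])
  from vector_derivative_diff_chain_within[OF this has_derivative_at_withinI[OF V_der]]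
  have "((\<lambda>t. V (X c t) (s + t)) has_vector_derivative
      J (X c t) (s + t) *v drift t (X c t) + Vt (X c t) (s + t))
      (at t within {0..T})"
    by (simp add: o_def)
  also have "J (X c t) (s + t) *v drift t (X c t) + Vt (X c t) (s + t)
      = - (a *\<^sub>R V (X c t) (s + t)) - G (X c t) (s + t)"
    by (simp add: G_eq drift_def matrix_vector_right_distrib matrix_vector_mult_scaleR algebra_simps)
  finally show ?thesis .
qed

lemma G_cont_comp:
  assumes "continuous_on S f" "continuous_on S g"
  shows "continuous_on S (\<lambda>x. G (f x) (g x))"
  unfolding G_eq by (intro continuous_intros V_cont_comp Vt_cont_comp J_cont_comp assms)

text \<open>With \<open>x(\<theta>)\<close> the transported loop, the time derivative of \<open>V \<bullet> x'\<close> is \<open>- (a - b) V \<bullet> x'\<close> plus the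
  \<open>\<theta>\<close>-derivative of \<open>|V|\<^sup>2 / 2 - P\<close>: the damping \<open>a V\<close> is partly compensated by the dilation \<open>b y\<close>,
  which stretches \<open>x'\<close>. The exact derivative integrates to zero over the closed loop, so that
  differentiability of \<open>P\<close> in space is enough.\<close>

theorem kelvin_circulation:
  fixes \<gamma> \<gamma>' :: "real \<Rightarrow> real^3" and p :: real
  defines "\<Gamma> \<equiv> \<lambda>t. integral {0..p} (\<lambda>\<theta>. V (X (\<gamma> \<theta>) t) (s + t) \<bullet> (Y (\<gamma> \<theta>) t *v \<gamma>' \<theta>))"
  assumes \<gamma>: "\<And>\<theta>. \<theta> \<in> {0..p} \<Longrightarrow> (\<gamma> has_vector_derivative \<gamma>' \<theta>) (at \<theta> within {0..p})"
    and \<gamma>': "continuous_on {0..p} \<gamma>'"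
    and closed: "\<gamma> 0 = \<gamma> p" and p: "0 \<le> p"
    and t: "t \<in> {0..T}"
  shows "\<Gamma> t = exp (- (a - b) * t) * \<Gamma> 0"
proof -
  let ?x = "\<lambda>t \<theta>. X (\<gamma> \<theta>) t" and ?x' = "\<lambda>t \<theta>. Y (\<gamma> \<theta>) t *v \<gamma>' \<theta>"
  let ?v = "\<lambda>t \<theta>. V (?x t \<theta>) (s + t)" and ?g = "\<lambda>t \<theta>. G (?x t \<theta>) (s + t)"
  let ?j = "\<lambda>t \<theta>. J (?x t \<theta>) (s + t)"
  let ?f = "\<lambda>t \<theta>. ?v t \<theta> \<bullet> ?x' t \<theta>"
  let ?f' = "\<lambda>t \<theta>. ?v t \<theta> \<bullet> (?j t \<theta> *v ?x' t \<theta> + b *\<^sub>R ?x' t \<theta>)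
      + (- (a *\<^sub>R ?v t \<theta>) - ?g t \<theta>) \<bullet> ?x' t \<theta>"
  let ?Q = "{0..T} \<times> {0..p}"
  have \<gamma>cont: "continuous_on {0..p} \<gamma>"
    using \<gamma> by (rule has_vector_derivative_imp_continuous_on)
  have \<gamma>Q: "continuous_on ?Q (\<lambda>q. \<gamma> (snd q))" "continuous_on ?Q (\<lambda>q. \<gamma>' (snd q))"
    by (rule continuous_on_compose2[OF \<gamma>cont continuous_on_snd[OF continuous_on_id]]
        continuous_on_compose2[OF \<gamma>' continuous_on_snd[OF continuous_on_id]], force)+
  have fst: "continuous_on ?Q fst" by (intro continuous_intros)
  have xQ: "continuous_on ?Q (\<lambda>q. ?x (fst q) (snd q))"
    and YQ: "continuous_on ?Q (\<lambda>q. Y (\<gamma> (snd q)) (fst q))"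
    using continuous_on_compose2[OF X_cont continuous_on_Pair[OF \<gamma>Q(1) fst]]
      continuous_on_compose2[OF Y_cont continuous_on_Pair[OF \<gamma>Q(1) fst]]
    by (simp_all add: image_subset_iff split_beta)
  have f'Q: "continuous_on ?Q (\<lambda>(t, \<theta>). ?f' t \<theta>)"
    unfolding split_beta
    by (intro continuous_intros V_cont_comp J_cont_comp G_cont_comp xQ YQ \<gamma>Q)
  have fQ: "continuous_on ?Q (\<lambda>(t, \<theta>). ?f t \<theta>)"
    unfolding split_beta by (intro continuous_intros V_cont_comp xQ YQ \<gamma>Q)
  have f_int: "?f t integrable_on {0..p}" if "t \<in> {0..T}" for t
  proof (rule integrable_continuous_real)
    have "continuous_on {0..p} (Pair t)" by (intro continuous_intros)
    from continuous_on_compose2[OF fQ this] that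
    show "continuous_on {0..p} (?f t)" by (auto simp: image_subset_iff)
  qed
  have time_der: "((\<lambda>t. ?f t \<theta>) has_vector_derivative ?f' t \<theta>) (at t within {0..T})"
    if "t \<in> {0..T}" for t \<theta>
    using has_derivative_inner[OF V_along_der[OF that, unfolded has_vector_derivative_def]
        Y_der[OF that, unfolded has_vector_derivative_def], of "\<gamma> \<theta>" "\<gamma> \<theta>" "\<gamma>' \<theta>"]
    unfolding drift_jacobian_v has_vector_derivative_def by (simp add: distrib_left inner_scaleR_right)
  have \<Gamma>_der: "(\<Gamma> has_vector_derivative integral {0..p} (?f' t)) (at t within {0..T})"
    if "t \<in> {0..T}" for t
    unfolding \<Gamma>_def cbox_interval[symmetric]
    by (rule leibniz_rule_vector_derivative)
      (use time_der f_int f'Q that in \<open>auto simp: cbox_interval\<close>)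
  have "integral {0..p} (?f' t) = - (a - b) * \<Gamma> t" if t: "t \<in> {0..T}" for t
  proof -
    let ?h = "\<lambda>\<theta>. (norm (?v t \<theta>))\<^sup>2 / 2 - P (?x t \<theta>) (s + t)"
    have "((\<lambda>\<theta>. ?v t \<theta> \<bullet> (?j t \<theta> *v ?x' t \<theta>) - ?g t \<theta> \<bullet> ?x' t \<theta>) has_integral ?h p - ?h 0) {0..p}"
    proof (rule fundamental_theorem_of_calculus[OF p])
      fix \<theta> assume \<theta>: "\<theta> \<in> {0..p}"
      have x: "(?x t has_vector_derivative ?x' t \<theta>) (at \<theta> within {0..p})"
        using vector_derivative_diff_chain_within[OF \<gamma>[OF \<theta>]
            has_derivative_at_withinI[OF X_has_derivative[OF t]]] by (simp add: o_def)
      have v: "(?v t has_vector_derivative ?j t \<theta> *v ?x' t \<theta>) (at \<theta> within {0..p})"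
        using vector_derivative_diff_chain_within[OF x has_derivative_at_withinI[OF V_space_der]]
        by (simp add: o_def)
      have "((\<lambda>\<theta>. (norm (?v t \<theta>))\<^sup>2 / 2) has_vector_derivative ?v t \<theta> \<bullet> (?j t \<theta> *v ?x' t \<theta>))
          (at \<theta> within {0..p})"
        using bounded_linear.has_vector_derivative[OF bounded_linear_divide[of 2]
            norm_square_has_derivative[OF v]] by simp
      moreover have "((\<lambda>\<theta>. P (?x t \<theta>) (s + t)) has_vector_derivative ?g t \<theta> \<bullet> ?x' t \<theta>)
          (at \<theta> within {0..p})"
        using vector_derivative_diff_chain_within[OF x
            has_derivative_at_withinI[OF P_grad[unfolded gderiv_def]]]
        by (simp add: o_def inner_commute)
      ultimately show "(?h has_vector_derivative
          ?v t \<theta> \<bullet> (?j t \<theta> *v ?x' t \<theta>) - ?g t \<theta> \<bullet> ?x' t \<theta>) (at \<theta> within {0..p})"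
        by (rule has_vector_derivative_diff)
    qed
    then have "((\<lambda>\<theta>. ?v t \<theta> \<bullet> (?j t \<theta> *v ?x' t \<theta>) - ?g t \<theta> \<bullet> ?x' t \<theta>) has_integral 0) {0..p}"
      by (simp add: closed)
    from has_integral_add[OF this has_integral_mult_right[OF integrable_integral[OF f_int[OF t]], of "- (a - b)"]]
    have "(?f' t has_integral - (a - b) * \<Gamma> t) {0..p}"
      by (simp add: \<Gamma>_def inner_simps algebra_simps)
    then show ?thesis by (rule integral_unique)
  qed
  with \<Gamma>_der have \<Gamma>': "(\<Gamma> has_vector_derivative - (a - b) * \<Gamma> t) (at t within {0..T})"
    if "t \<in> {0..T}" for t using that by simp
  have "exp (- (a - b) * t) * \<Gamma> 0 \<le> \<Gamma> t"
    by (rule exponential_lower_comparison[OF \<Gamma>' _ t]) auto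
  moreover have "\<Gamma> t \<le> exp (- (a - b) * t) * (\<Gamma> 0 + 0 * t)"
    by (rule exponential_comparison[OF \<Gamma>' _ t]) auto
  ultimately show ?thesis by simp
qed

text \<open>The infinitesimal form of \<open>kelvin_circulation\<close>: both sides are limits of circulations around
  shrinking ellipses at \<open>c\<close>.\<close>

lemma axial_form_transport:
  assumes t: "t \<in> {0..T}"
  shows "(J (X c t) (s + t) *v (Y c t *v u)) \<bullet> (Y c t *v v) - (J (X c t) (s + t) *v (Y c t *v v)) \<bullet> (Y c t *v u)
    = exp (- (a - b) * t) * ((J c s *v u) \<bullet> v - (J c s *v v) \<bullet> u)"
proof -
  define \<epsilon> where "\<epsilon> k = inverse (real (Suc k))" for k
  have \<epsilon>: "\<epsilon> \<longlonglongrightarrow> 0" "\<And>k. 0 < \<epsilon> k" "\<And>k. \<epsilon> k \<le> 1"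
    unfolding \<epsilon>_def[abs_def] by (rule LIMSEQ_inverse_real_of_nat) (simp_all add: inverse_le_1_iff)
  let ?I = "\<lambda>k t. integral {0..2 * pi} (\<lambda>\<theta>. V (X (c + \<epsilon> k *\<^sub>R circle u v \<theta>) t) (s + t) \<bullet>
      (Y (c + \<epsilon> k *\<^sub>R circle u v \<theta>) t *v circle' u v \<theta>))"
  let ?B = "\<lambda>t. (J (X c t) (s + t) *v (Y c t *v u)) \<bullet> (Y c t *v v)
      - (J (X c t) (s + t) *v (Y c t *v v)) \<bullet> (Y c t *v u)"
  have lim: "(\<lambda>k. ?I k t / \<epsilon> k) \<longlonglongrightarrow> pi * ?B t" if t: "t \<in> {0..T}" for t
  proof (rule circulation_density[where K = "K * C" and f = "\<lambda>c. V (X c t) (s + t)"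
        and f' = "\<lambda>h. J (X c t) (s + t) *v (Y c t *v h)" and g = "\<lambda>c. X c t", OF _ _ _ _ \<epsilon>])
    show "((\<lambda>c. V (X c t) (s + t)) has_derivative (\<lambda>h. J (X c t) (s + t) *v (Y c t *v h))) (at c)"
      using has_derivative_compose[OF X_has_derivative[OF t] V_space_der] by simp
    have "0 \<le> K" using J_le norm_ge_zero order_trans by blast
    then show "norm (V (X x t) (s + t) - V (X y t) (s + t)) \<le> K * C * norm (x - y)" for x y
      using mult_left_mono[OF X_lipschitz[OF t, of x y], of K]
      by (intro order_trans[OF V_lipschitz]) (simp add: mult.assoc)
    show "((\<lambda>c. X c t) has_derivative (*v) (Y x t)) (at x)" for x
      by (rule X_has_derivative[OF t])
    show "continuous_on UNIV (\<lambda>c. Y c t)"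
      using continuous_on_compose2[OF Y_cont continuous_on_Pair[OF continuous_on_id continuous_on_const]] t
      by (simp add: image_subset_iff)
  qed
  have I: "?I k t = exp (- (a - b) * t) * ?I k 0" for k
  proof -
    let ?\<gamma> = "\<lambda>\<theta>. c + \<epsilon> k *\<^sub>R circle u v \<theta>" and ?\<gamma>' = "\<lambda>\<theta>. \<epsilon> k *\<^sub>R circle' u v \<theta>"
    have "integral {0..2 * pi} (\<lambda>\<theta>. V (X (?\<gamma> \<theta>) t) (s + t) \<bullet> (Y (?\<gamma> \<theta>) t *v ?\<gamma>' \<theta>))
      = exp (- (a - b) * t) * integral {0..2 * pi} (\<lambda>\<theta>. V (X (?\<gamma> \<theta>) 0) (s + 0) \<bullet> (Y (?\<gamma> \<theta>) 0 *v ?\<gamma>' \<theta>))"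
    proof (rule kelvin_circulation[OF _ _ _ _ t])
      show "(?\<gamma> has_vector_derivative ?\<gamma>' \<theta>) (at \<theta> within {0..2 * pi})" for \<theta>
        using has_vector_derivative_add[OF has_vector_derivative_const[of c]
            bounded_linear.has_vector_derivative[OF bounded_linear_scaleR_right circle_der]] by simp
      show "continuous_on {0..2 * pi} ?\<gamma>'" by (intro continuous_intros circle_cont)
      show "?\<gamma> 0 = ?\<gamma> (2 * pi)" by (simp add: circle_closed)
    qed simp
    then show ?thesis using \<epsilon>(2)[of k] by (simp add: matrix_vector_mult_scaleR)
  qed
  have "(\<lambda>k. exp (- (a - b) * t) * (?I k 0 / \<epsilon> k)) \<longlonglongrightarrow> exp (- (a - b) * t) * (pi * ?B 0)"
    using T_nonneg by (intro tendsto_mult_left lim) simp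
  then have "(\<lambda>k. ?I k t / \<epsilon> k) \<longlonglongrightarrow> exp (- (a - b) * t) * (pi * ?B 0)"
    unfolding I by simp
  from LIMSEQ_unique[OF lim[OF t] this] show ?thesis by simp
qed

lemma det_Y: "t \<in> {0..T} \<Longrightarrow> det (Y c t) = exp (3 * b * t)"
proof -
  assume t: "t \<in> {0..T}"
  have "trace (M + b *\<^sub>R mat 1) = trace M + 3 * b" for M :: "real^3^3"
    by (simp add: trace_def mat_def sum_3)
  then have "trace (drift_jacobian r (X c r)) = 3 * b" for r
    by (simp add: drift_jacobian_def trace_J)
  from liouville_det[of T "Y c" "\<lambda>t. drift_jacobian t (X c t)", OF Y_der this t]
  show ?thesis by simp
qed

text \<open>The transported 2-form of \<open>axial_form_transport\<close> expressed as a vector: passing from 2-forms to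
  vectors divides by \<open>det Y = exp (3 b t)\<close>, which turns the rate \<open>a - b\<close> into \<open>a + 2 b\<close>.\<close>

theorem cauchy_vorticity_formula:
  assumes t: "t \<in> {0..T}"
  shows "axial_vector (J (X c t) (s + t)) = exp (- (a + 2 * b) * t) *\<^sub>R (Y c t *v axial_vector (J c s))"
proof (rule eq_if_inner_cross_eq)
  show "det (Y c t) \<noteq> 0" using det_Y[OF t] by simp
  fix u v
  have "axial_vector (J (X c t) (s + t)) \<bullet> cross3 (Y c t *v u) (Y c t *v v)
      = exp (- (a - b) * t) * (axial_vector (J c s) \<bullet> cross3 u v)"
    unfolding axial_vector_inner_cross by (rule axial_form_transport[OF t])
  also have "\<dots> = exp (- (a + 2 * b) * t) * (axial_vector (J c s) \<bullet> (det (Y c t) *\<^sub>R cross3 u v))"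
  proof -
    have "- (a - b) * t = - (a + 2 * b) * t + 3 * b * t" by (simp add: algebra_simps)
    then have "exp (- (a - b) * t) = exp (- (a + 2 * b) * t) * exp (3 * b * t)"
      by (simp only: exp_add)
    then show ?thesis by (simp add: det_Y[OF t])
  qed
  also have "axial_vector (J c s) \<bullet> (det (Y c t) *\<^sub>R cross3 u v)
      = (Y c t *v axial_vector (J c s)) \<bullet> cross3 (Y c t *v u) (Y c t *v v)"
    unfolding cross_matrix_mult[symmetric] by (metis dot_lmul_matrix inner_commute transpose_matrix_vector)
  finally show "axial_vector (J (X c t) (s + t)) \<bullet> cross3 (Y c t *v u) (Y c t *v v)
      = (exp (- (a + 2 * b) * t) *\<^sub>R (Y c t *v axial_vector (J c s))) \<bullet> cross3 (Y c t *v u) (Y c t *v v)"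
    by simp
qed

end

section \<open>Densities expanded by a self-map\<close>

text \<open>By the change of variables formula the integral of \<open>F\<close> over \<open>S\<close> is at least the integral over
  \<open>\<Phi> ` S\<close>, hence at least \<open>\<mu> > 1\<close> times itself. Being finite it is zero, and so is the
  continuous nonnegative function \<open>F\<close>. Besides the weighted vorticity this is applied to \<open>F = 1\<close>, where
  it shows that \<open>S\<close> is empty.\<close>

theorem expanding_self_map_vanishing:
  fixes \<Phi> :: "real^'n::{finite,wellorder} \<Rightarrow> real^'n::_" and F :: "real^'n::_ \<Rightarrow> real"
  assumes S: "open S"
    and der: "\<And>x. x \<in> S \<Longrightarrow> (\<Phi> has_derivative \<Phi>' x) (at x)"
    and inj: "inj_on \<Phi> S" and self: "\<Phi> ` S \<subseteq> S"
    and F: "continuous_on S F" "\<And>x. x \<in> S \<Longrightarrow> 0 \<le> F x" "F absolutely_integrable_on S"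
    and expand: "\<And>x. x \<in> S \<Longrightarrow> \<mu> * F x \<le> \<bar>det (matrix (\<Phi>' x))\<bar> * F (\<Phi> x)"
    and \<mu>: "\<mu> > 1"
    and x: "x \<in> S"
  shows "F x = 0"
proof -
  have S_leb: "S \<in> sets lebesgue" using S by (simp add: borel_open)
  have der_within: "(\<Phi> has_derivative \<Phi>' x) (at x within S)" if "x \<in> S" for x
    by (rule has_derivative_at_withinI[OF der[OF that]])
  then have "\<Phi> differentiable_on S"
    unfolding differentiable_on_def differentiable_def by blast
  then have im_leb: "\<Phi> ` S \<in> sets lebesgue"
    by (intro differentiable_image_in_sets_lebesgue S_leb) auto
  have F_im: "F absolutely_integrable_on \<Phi> ` S"
    by (rule set_integrable_subset[OF F(3) im_leb self])
  \<comment> \<open>The change of variables theorem speaks of vector-valued functions, hence the detour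
    through one-dimensional vectors.\<close>
  have "(\<lambda>x. \<bar>det (matrix (\<Phi>' x))\<bar> *\<^sub>R vec (F (\<Phi> x)) :: real^1) absolutely_integrable_on S \<and>
      integral S (\<lambda>x. \<bar>det (matrix (\<Phi>' x))\<bar> *\<^sub>R vec (F (\<Phi> x)) :: real^1) = vec (integral (\<Phi> ` S) F)"
    by (subst has_absolute_integral_change_of_variables[OF S_leb der_within inj])
      (use F_im in \<open>simp_all add: absolutely_integrable_on_1_iff integral_on_1_eq\<close>)
  then have cov: "(\<lambda>x. \<bar>det (matrix (\<Phi>' x))\<bar> * F (\<Phi> x)) absolutely_integrable_on S"
    "integral S (\<lambda>x. \<bar>det (matrix (\<Phi>' x))\<bar> * F (\<Phi> x)) = integral (\<Phi> ` S) F"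
    by (simp_all add: absolutely_integrable_on_1_iff integral_on_1_eq vec_eq_iff)
  have "\<mu> * integral S F = integral S (\<lambda>x. \<mu> * F x)" by simp
  also have "\<dots> \<le> integral S (\<lambda>x. \<bar>det (matrix (\<Phi>' x))\<bar> * F (\<Phi> x))"
    using expand F(3) cov(1) integrable_cmul[of F S \<mu>]
    by (intro integral_le) (auto simp: absolutely_integrable_on_def)
  also have "\<dots> \<le> integral S F"
    unfolding cov(2) using F F_im self
    by (intro integral_subset_le) (auto simp: absolutely_integrable_on_def)
  finally have "(\<mu> - 1) * integral S F \<le> 0" by (simp add: algebra_simps)
  then have int_le: "integral S F \<le> 0" using \<mu> by (simp add: mult_le_0_iff)
  obtain p q where pq: "cbox p q \<subseteq> S" "x \<in> box p q"
    by (rule open_contains_cbox[OF S x]) (rule that)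
  have F_pq: "F integrable_on cbox p q"
    by (intro integrable_continuous continuous_on_subset[OF F(1)] pq)
  have "integral (cbox p q) F \<le> integral S F"
    using F pq F_pq by (intro integral_subset_le) (auto simp: absolutely_integrable_on_def)
  moreover have "0 \<le> integral (cbox p q) F"
    using F pq by (intro integral_nonneg F_pq) auto
  ultimately have "integral (cbox p q) F = 0" using int_le by simp
  then have "(F has_integral 0) (cbox p q)" using F_pq by (simp add: has_integral_iff)
  then show ?thesis
    using has_integral_0_cbox_imp_0[of p q F x] F pq box_subset_cbox[of p q]
    by (auto intro: continuous_on_subset)
qed

section \<open>Fields without curl and divergence that vanish at infinity\<close>

lemma not_local_max_if_second_derivative_pos:
  fixes f f' :: "real \<Rightarrow> real"
  assumes f: "\<And>t. (f has_real_derivative f' t) (at t)"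
    and f'': "(f' has_real_derivative m) (at 0)" and m: "m > 0"
    and max: "\<And>t. \<bar>t\<bar> < d \<Longrightarrow> f t \<le> f 0" and d: "d > 0"
  shows False
proof -
  have f'0: "f' 0 = 0"
    by (rule DERIV_local_max[OF f d]) (use max in auto)
  obtain e where e: "e > 0" "\<And>h. 0 < h \<Longrightarrow> h < e \<Longrightarrow> f' 0 < f' (0 + h)"
    using DERIV_pos_inc_right[OF f'' m] by auto
  define r where "r = min d e / 2"
  have r: "0 < r" "r < d" "r < e" using d e(1) by (auto simp: r_def)
  have "f 0 < f r"
  proof (rule DERIV_pos_imp_increasing_open[OF r(1)])
    show "\<exists>y. (f has_real_derivative y) (at t) \<and> 0 < y" if "0 < t" "t < r" for t
      using f[of t] e(2)[of t] that r f'0 by auto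
    show "continuous_on {0..r} f"
      using f by (intro DERIV_continuous_on) (blast intro: has_field_derivative_at_within)
  qed
  with max[of r] r show False by simp
qed

text \<open>Maximum principle. If \<open>g x0 > 0\<close>, then \<open>g + \<delta> |x|\<^sup>2\<close> with small \<open>\<delta>\<close> still attains its maximum over a
  large ball in the interior, although its Laplacian \<open>2 n \<delta>\<close> is positive; so along some coordinate
  axis its second derivative there is positive.\<close>

lemma harmonic_le_0_if_vanishing_at_infinity:
  fixes g :: "real^'n \<Rightarrow> real" and G :: "real^'n \<Rightarrow> real^'n" and H :: "real^'n \<Rightarrow> real^'n^'n"
  assumes g: "\<And>x. (g has_derivative (\<lambda>h. G x \<bullet> h)) (at x)"
    and G: "\<And>x. (G has_derivative (\<lambda>h. H x *v h)) (at x)"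
    and trace: "\<And>x. trace (H x) = 0"
    and lim: "(g \<longlongrightarrow> 0) at_infinity"
  shows "g x0 \<le> 0"
proof (rule ccontr)
  assume "\<not> g x0 \<le> 0"
  then have pos: "g x0 > 0" by simp
  obtain R0 where R0: "\<And>x. R0 \<le> norm x \<Longrightarrow> \<bar>g x\<bar> < g x0 / 2"
    using tendstoD[OF lim, of "g x0 / 2"] pos by (auto simp: eventually_at_infinity)
  define R where "R = \<bar>R0\<bar> + norm x0 + 1"
  have R: "R0 \<le> R" "norm x0 < R" "0 < R"
    unfolding R_def using norm_ge_zero[of x0] abs_ge_self[of R0] abs_ge_zero[of R0] by linarith+
  \<comment> \<open>On the sphere of radius \<open>R\<close> the perturbed function is below \<open>g x0 / 2 + g x0 / 4\<close>, hence below
    its value at \<open>x0\<close>.\<close>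
  define \<delta> where "\<delta> = g x0 / (4 * R\<^sup>2)"
  have \<delta>: "0 < \<delta>" "\<delta> * R\<^sup>2 = g x0 / 4" using pos R by (auto simp: \<delta>_def)
  define p where "p x = g x + \<delta> * (x \<bullet> x)" for x
  have "continuous_on (cball 0 R) p"
    unfolding p_def by (intro continuous_intros has_derivative_continuous_on[OF has_derivative_at_withinI[OF g]])
  then obtain x1 where x1: "x1 \<in> cball 0 R" "\<And>y. y \<in> cball 0 R \<Longrightarrow> p y \<le> p x1"
    using continuous_attains_sup[of "cball 0 R" p] R by auto
  have "norm x1 < R"
  proof (rule ccontr)
    assume "\<not> norm x1 < R"
    with x1 have "norm x1 = R" by auto
    then have "p x1 < g x0 / 2 + g x0 / 4"
      using R0[of x1] R \<delta> by (simp add: p_def power2_norm_eq_inner[symmetric])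
    moreover have "g x0 \<le> p x0" using \<delta> by (simp add: p_def)
    moreover have "p x0 \<le> p x1" using R by (intro x1) simp
    ultimately show False using pos by simp
  qed
  have "(\<Sum>i\<in>UNIV. H x1 $ i $ i + 2 * \<delta>) > 0"
    using trace[of x1] \<delta> by (simp add: sum.distrib trace_def)
  then obtain i where i: "H x1 $ i $ i + 2 * \<delta> > 0"
    by (meson linorder_not_less sum_nonpos)
  define e where "e = (axis i 1 :: real^'n)"
  have e: "e \<bullet> e = 1" "norm e = 1" "v \<bullet> e = v $ i" for v
    by (simp_all add: e_def inner_axis)
  have line: "((\<lambda>t. x1 + t *\<^sub>R e) has_vector_derivative e) (at t)" for t
    by (auto intro!: derivative_eq_intros)
  show False
  proof (rule not_local_max_if_second_derivative_pos)
    fix t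
    have "((\<lambda>t. g (x1 + t *\<^sub>R e)) has_real_derivative G (x1 + t *\<^sub>R e) \<bullet> e) (at t)"
      using vector_derivative_diff_chain_within[OF line has_derivative_at_withinI[OF g]]
      by (simp add: o_def has_real_derivative_iff_has_vector_derivative)
    moreover have "((\<lambda>t. \<delta> * ((x1 + t *\<^sub>R e) \<bullet> (x1 + t *\<^sub>R e))) has_real_derivative
        2 * \<delta> * ((x1 + t *\<^sub>R e) \<bullet> e)) (at t)"
      unfolding inner_simps by (auto intro!: derivative_eq_intros simp: inner_commute algebra_simps)
    ultimately show "((\<lambda>t. p (x1 + t *\<^sub>R e)) has_real_derivative
        G (x1 + t *\<^sub>R e) \<bullet> e + 2 * \<delta> * ((x1 + t *\<^sub>R e) \<bullet> e)) (at t)"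
      unfolding p_def by (rule DERIV_add)
  next
    have "((\<lambda>t. G (x1 + t *\<^sub>R e)) has_vector_derivative H (x1 + 0 *\<^sub>R e) *v e) (at 0)"
      using vector_derivative_diff_chain_within[OF line[of 0] has_derivative_at_withinI[OF G]]
      by (simp add: o_def)
    from bounded_linear.has_vector_derivative[OF bounded_linear_inner_left[of e] this]
    have "((\<lambda>t. G (x1 + t *\<^sub>R e) \<bullet> e) has_real_derivative H x1 $ i $ i) (at 0)"
      unfolding e(3)
      by (simp add: has_real_derivative_iff_has_vector_derivative e_def matrix_vector_mult_basis column_def)
    moreover have "((\<lambda>t. 2 * \<delta> * ((x1 + t *\<^sub>R e) \<bullet> e)) has_real_derivative 2 * \<delta>) (at 0)"
      unfolding inner_simps e(1) by (auto intro!: derivative_eq_intros)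
    ultimately show "((\<lambda>t. G (x1 + t *\<^sub>R e) \<bullet> e + 2 * \<delta> * ((x1 + t *\<^sub>R e) \<bullet> e))
        has_real_derivative H x1 $ i $ i + 2 * \<delta>) (at 0)"
      by (rule DERIV_add)
  next
    fix t :: real assume "\<bar>t\<bar> < R - norm x1"
    then have "norm (x1 + t *\<^sub>R e) \<le> R"
      using norm_triangle_ineq[of x1 "t *\<^sub>R e"] e(2) by simp
    then show "p (x1 + t *\<^sub>R e) \<le> p (x1 + 0 *\<^sub>R e)"
      using x1(2)[of "x1 + t *\<^sub>R e"] by simp
  qed (use i \<open>norm x1 < R\<close> in auto)
qed

lemma continuous_on_transpose:
  fixes f :: "'a::topological_space \<Rightarrow> real^'n^'m"
  assumes "continuous_on S f"
  shows "continuous_on S (\<lambda>x. transpose (f x))"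
proof -
  have "linear (transpose :: real^'n^'m \<Rightarrow> real^'m^'n)"
    by (rule linearI) (simp_all add: transpose_def vec_eq_iff)
  then show ?thesis
    using assms by (simp add: linear_conv_bounded_linear bounded_linear.continuous_on)
qed

lemma at_infinity_nontrivial: "at_infinity \<noteq> (bot :: 'a::euclidean_space filter)"
proof
  assume "at_infinity = (bot :: 'a filter)"
  then have "eventually (\<lambda>_. False) (at_infinity :: 'a filter)" by simp
  then obtain r where r: "\<And>x :: 'a. \<not> r \<le> norm x" by (auto simp: eventually_at_infinity)
  obtain x :: 'a where "norm x = \<bar>r\<bar>" using vector_choose_size[of "\<bar>r\<bar>"] by auto
  with r[of x] show False by simp
qed

text \<open>\<open>v\<close> is only \<open>C\<^sup>1\<close>, so its components have no Laplacian. The line integral \<open>g h\<close> of \<open>v\<close> over the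
  segment from \<open>x\<close> to \<open>x + h\<close> is one order smoother: symmetry of \<open>D\<close> makes its gradient
  \<open>v (x + h) - v x\<close>, whose divergence is zero. In contrast to a potential of \<open>v\<close>, it tends to
  zero at infinity, so the maximum principle applies to it.\<close>

theorem curl_div_free_field_eq_0:
  fixes v :: "real^'n \<Rightarrow> real^'n" and D :: "real^'n \<Rightarrow> real^'n^'n"
  assumes v: "\<And>x. (v has_derivative (\<lambda>h. D x *v h)) (at x)"
    and D_cont: "continuous_on UNIV D"
    and sym: "\<And>x h k. (D x *v h) \<bullet> k = (D x *v k) \<bullet> h"
    and trace: "\<And>x. trace (D x) = 0"
    and lim: "(v \<longlongrightarrow> 0) at_infinity"
  shows "v x = 0"
proof -
  have v_cont: "continuous_on UNIV v"
    using v by (intro has_derivative_continuous_on) (auto intro: has_derivative_at_withinI)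
  have "v (x + h) = v x" for x h
  proof -
    define g where "g h x = integral {0..1} (\<lambda>t. v (x + t *\<^sub>R h) \<bullet> h)" for h x :: "real^'n"
    have g_der: "(g h has_derivative (\<lambda>k. (v (x + h) - v x) \<bullet> k)) (at x)" for h x
    proof -
      define B where "B x t = blinfun_inner_right (transpose (D (x + t *\<^sub>R h)) *v h)" for x t
      have B: "blinfun_apply (B x t) = (\<lambda>k. (D (x + t *\<^sub>R h) *v k) \<bullet> h)" for x t
        unfolding B_def blinfun_inner_right.rep_eq fun_eq_iff
        by (metis dot_lmul_matrix inner_commute transpose_matrix_vector)
      have D_line: "continuous_on S (\<lambda>p. D (f p + r p *\<^sub>R h))"
        if "continuous_on S f" "continuous_on S r" for S :: "'b::topological_space set" and f r
        by (rule continuous_on_compose2[OF D_cont]) (intro continuous_intros that subset_UNIV)+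
      have "(g h has_derivative integral (cbox 0 1) (B x)) (at x within UNIV)"
        unfolding g_def cbox_interval[symmetric]
      proof (rule leibniz_rule)
        fix x :: "real^'n" and t :: real
        have "((\<lambda>x. v (x + t *\<^sub>R h)) has_derivative (\<lambda>k. D (x + t *\<^sub>R h) *v k)) (at x)"
          by (rule has_derivative_compose[OF _ v]) (auto intro!: derivative_eq_intros)
        from has_derivative_inner_left[OF this, of h]
        show "((\<lambda>x. v (x + t *\<^sub>R h) \<bullet> h) has_derivative blinfun_apply (B x t)) (at x within UNIV)"
          unfolding B .
        show "(\<lambda>t. v (x + t *\<^sub>R h) \<bullet> h) integrable_on cbox 0 1"
          by (intro integrable_continuous continuous_intros continuous_on_compose2[OF v_cont]) auto
        show "continuous_on (UNIV \<times> cbox 0 1) (\<lambda>(x, t). B x t)"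
          unfolding B_def split_beta
          by (rule bounded_linear.continuous_on[OF bounded_linear_blinfun_inner_right]
            continuous_on_matrix_vector continuous_on_transpose D_line continuous_on_const
            continuous_on_fst continuous_on_snd continuous_on_id)+
      qed auto
      moreover have "blinfun_apply (integral (cbox 0 1) (B x)) = (\<lambda>k. (v (x + h) - v x) \<bullet> k)"
      proof
        fix k
        have "B x integrable_on cbox 0 1"
          unfolding B_def
          by (rule integrable_continuous bounded_linear.continuous_on[OF bounded_linear_blinfun_inner_right]
            continuous_on_matrix_vector continuous_on_transpose D_line continuous_on_const continuous_on_id)+
        from has_integral_linear[OF integrable_integral[OF this] blinfun.bounded_linear_left[of k]]
        have "((\<lambda>t. (D (x + t *\<^sub>R h) *v k) \<bullet> h) has_integral blinfun_apply (integral (cbox 0 1) (B x)) k) {0..1}"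
          by (simp add: o_def B)
        moreover have "((\<lambda>t. (D (x + t *\<^sub>R h) *v k) \<bullet> h) has_integral
            v (x + 1 *\<^sub>R h) \<bullet> k - v (x + 0 *\<^sub>R h) \<bullet> k) {0..1}"
        proof (rule fundamental_theorem_of_calculus)
          fix t :: real
          have "((\<lambda>t. x + t *\<^sub>R h) has_vector_derivative h) (at t within {0..1})"
            by (auto intro!: derivative_eq_intros)
          from vector_derivative_diff_chain_within[OF this has_derivative_at_withinI[OF v]]
          have "((\<lambda>t. v (x + t *\<^sub>R h)) has_vector_derivative D (x + t *\<^sub>R h) *v h) (at t within {0..1})"
            by (simp add: o_def)
          from bounded_linear.has_vector_derivative[OF bounded_linear_inner_left[of k] this]
          show "((\<lambda>t. v (x + t *\<^sub>R h) \<bullet> k) has_vector_derivative (D (x + t *\<^sub>R h) *v k) \<bullet> h)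
              (at t within {0..1})"
            by (simp add: sym)
        qed simp
        ultimately show "blinfun_apply (integral (cbox 0 1) (B x)) k = (v (x + h) - v x) \<bullet> k"
          by (auto simp: inner_diff_left dest: has_integral_unique)
      qed
      ultimately show ?thesis by simp
    qed
    have g_lim: "(g h \<longlongrightarrow> 0) at_infinity" for h
    proof (rule tendstoI)
      fix e :: real assume e: "e > 0"
      obtain d where d: "d > 0" "norm h * d < e"
        using small_factor[of "norm h" e] e by auto
      obtain R where R: "\<And>x. R \<le> norm x \<Longrightarrow> norm (v x) < d"
        using tendstoD[OF lim d(1)] by (auto simp: eventually_at_infinity)
      have "dist (g h x) 0 < e" if x: "R + norm h \<le> norm x" for x
      proof -
        have "norm (integral {0..1} (\<lambda>t. v (x + t *\<^sub>R h) \<bullet> h)) \<le> d * norm h * (1 - 0)"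
        proof (rule integral_bound)
          show "continuous_on {0..1} (\<lambda>t. v (x + t *\<^sub>R h) \<bullet> h)"
            by (intro continuous_intros continuous_on_compose2[OF v_cont]) auto
          fix t :: real assume t: "t \<in> {0..1}"
          have "norm (t *\<^sub>R h) \<le> norm h" using t by (simp add: mult_left_le_one_le)
          then have "R \<le> norm (x + t *\<^sub>R h)"
            using norm_triangle_ineq2[of x "- (t *\<^sub>R h)"] x by simp
          then have "norm (v (x + t *\<^sub>R h)) \<le> d" using R by (simp add: less_imp_le)
          then show "norm (v (x + t *\<^sub>R h) \<bullet> h) \<le> d * norm h"
            unfolding real_norm_def
            by (intro order_trans[OF Cauchy_Schwarz_ineq2] mult_right_mono) auto
        qed simp
        also have "\<dots> < e" using d by (simp add: mult.commute)
        finally show ?thesis by (simp add: g_def)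
      qed
      then show "\<forall>\<^sub>F x in at_infinity. dist (g h x) 0 < e"
        by (auto simp: eventually_at_infinity)
    qed
    have v_shift: "((\<lambda>x. v (x + h)) has_derivative (\<lambda>k. D (x + h) *v k)) (at x)" for x h
      by (rule has_derivative_compose[OF _ v]) (auto intro!: derivative_eq_intros)
    have g_le: "g h x \<le> 0" for h x
    proof (rule harmonic_le_0_if_vanishing_at_infinity[OF g_der _ _ g_lim])
      fix x
      from has_derivative_diff[OF v_shift v]
      show "((\<lambda>x. v (x + h) - v x) has_derivative (\<lambda>k. (D (x + h) - D x) *v k)) (at x)"
        by (simp add: matrix_vector_mult_diff_rdistrib)
      show "trace (D (x + h) - D x) = 0" by (simp add: trace_sub trace)
    qed
    have "g h x = 0" for h x
    proof -
      have "- g h x \<le> 0"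
      proof (rule harmonic_le_0_if_vanishing_at_infinity)
        show "((\<lambda>x. - g h x) has_derivative (\<lambda>k. (v x - v (x + h)) \<bullet> k)) (at x)" for x
          using has_derivative_minus[OF g_der[of h x]] by (simp add: inner_diff_left)
        show "((\<lambda>x. v x - v (x + h)) has_derivative (\<lambda>k. (D x - D (x + h)) *v k)) (at x)" for x
          using has_derivative_diff[OF v v_shift[where x = x and h = h]]
          by (simp add: matrix_vector_mult_diff_rdistrib)
        show "trace (D x - D (x + h)) = 0" for x by (simp add: trace_sub trace)
        show "((\<lambda>x. - g h x) \<longlongrightarrow> 0) at_infinity"
          using tendsto_minus[OF g_lim[of h]] by simp
      qed
      with g_le[of h x] show ?thesis by simp
    qed
    then have "g h = (\<lambda>x. 0)" by blast
    with g_der[of h x] have "((\<lambda>x. 0) has_derivative (\<lambda>k. (v (x + h) - v x) \<bullet> k)) (at x)" by simp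
    from has_derivative_unique[OF this has_derivative_const]
    have "(v (x + h) - v x) \<bullet> (v (x + h) - v x) = 0" by (rule fun_cong)
    then show ?thesis by simp
  qed
  from this[of 0] have const: "v y = v 0" for y by simp
  have "((\<lambda>y::real^'n. v 0) \<longlongrightarrow> 0) at_infinity"
    by (rule Lim_transform_eventually[OF lim]) (rule always_eventually, rule allI, rule const)
  then have "v 0 = 0"
    using tendsto_unique[OF at_infinity_nontrivial tendsto_const] by metis
  with const show ?thesis by simp
qed

section \<open>Behaviour of the flow far from the origin\<close>

lemma periodic_reduce:
  fixes f :: "real \<Rightarrow> 'a"
  assumes p: "p > 0" and f: "\<And>s. f (s + p) = f s"
  obtains r where "r \<in> {0..<p}" "f s = f r"
proof -
  have nat: "f (s + real n * p) = f s" for s n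
  proof (induction n)
    case (Suc n)
    have "f (s + real (Suc n) * p) = f ((s + real n * p) + p)" by (simp add: algebra_simps)
    with Suc f show ?case by simp
  qed simp
  define k where "k = \<lfloor>s / p\<rfloor>"
  define r where "r = s - of_int k * p"
  have "of_int k \<le> s / p" "s / p < of_int k + 1" by (simp_all add: k_def)
  then have r: "r \<in> {0..<p}" using p by (simp add: r_def field_simps)
  have "f s = f r"
  proof (cases "k \<ge> 0")
    case True
    then have "s = r + real (nat k) * p" by (simp add: r_def)
    then show ?thesis using nat by metis
  next
    case False
    then have "r = s + real (nat (- k)) * p" by (simp add: r_def)
    then show ?thesis using nat by metis
  qed
  with r that show ?thesis by blast
qed

text \<open>For \<open>y\<close> outside the ball of radius \<open>R\<close>, apply the mean value inequality on the radial segment from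
  the sphere to \<open>y\<close>, which stays in the region where the derivative is small.\<close>

lemma norm_le_affine_if_derivative_small_far:
  fixes f :: "'a::real_normed_vector \<Rightarrow> 'b::real_normed_vector"
  assumes f: "\<And>x. (f has_derivative f' x) (at x)"
    and far: "\<And>x h. R \<le> norm x \<Longrightarrow> norm (f' x h) \<le> \<epsilon> * norm h"
    and near: "\<And>x. norm x \<le> R \<Longrightarrow> norm (f x) \<le> M"
    and R: "0 < R" and \<epsilon>: "0 \<le> \<epsilon>"
  shows "norm (f y) \<le> M + \<epsilon> * norm y"
proof (cases "norm y \<le> R")
  case True
  then show ?thesis using near[of y] \<epsilon> by (simp add: add_increasing2)
next
  case False
  then have "0 < norm y" using R by linarith
  then have y: "y \<noteq> 0" by simp
  define z where "z = (R / norm y) *\<^sub>R y"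
  have z: "norm z = R" using R False by (auto simp: z_def)
  have zy: "norm (y - z) \<le> norm y"
  proof -
    have "y - z = (1 - R / norm y) *\<^sub>R y" by (simp add: z_def scaleR_diff_left)
    moreover have "0 \<le> R / norm y" "R / norm y \<le> 1" using R False y by simp_all
    then have "\<bar>1 - R / norm y\<bar> \<le> 1" by (simp add: abs_le_iff)
    ultimately show ?thesis by (simp add: mult_left_le_one_le)
  qed
  have "norm (f y - f z) \<le> \<epsilon> * norm (y - z)"
  proof (rule differentiable_bound[of "closed_segment z y" f f'])
    fix w assume "w \<in> closed_segment z y"
    then obtain u where u: "0 \<le> u" "u \<le> 1" "w = (1 - u) *\<^sub>R z + u *\<^sub>R y"
      by (auto simp: in_segment)
    have "w = ((1 - u) * (R / norm y) + u) *\<^sub>R y" by (simp add: u z_def scaleR_add_left)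
    moreover have "0 \<le> (1 - u) * (R / norm y) + u" using u R by simp
    ultimately have "norm w = ((1 - u) * (R / norm y) + u) * norm y" by simp
    also have "\<dots> = (1 - u) * R + u * norm y" using y by (simp add: field_simps)
    also have "\<dots> \<ge> (1 - u) * R + u * R" using u False by (intro add_left_mono mult_left_mono) auto
    finally have "R \<le> norm w" by (simp add: algebra_simps)
    then show "onorm (f' w) \<le> \<epsilon>" by (intro onorm_bound far \<epsilon>)
  qed (auto intro: has_derivative_at_withinI f)
  also have "\<dots> \<le> \<epsilon> * norm y" using zy \<epsilon> by (rule mult_left_mono)
  finally have "norm (f y - f z) \<le> \<epsilon> * norm y" .
  moreover have "norm (f z) \<le> M" using near z by simp
  moreover have "norm (f y) \<le> norm (f z) + norm (f y - f z)" by (metis add.commute diff_add_cancel norm_triangle_ineq)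
  ultimately show ?thesis by linarith
qed

lemma exp_mult_square: "(exp (k * t) * x)\<^sup>2 = exp (2 * k * t) * x\<^sup>2" for x :: real
  by (simp add: power_mult_distrib exp_double[symmetric] mult.assoc)

lemma exp_mult_powr:
  fixes x :: real
  assumes "0 \<le> x"
  shows "(exp k * x) powr \<eta> = exp (k * \<eta>) * x powr \<eta>"
proof -
  have "exp k powr \<eta> = exp (k * \<eta>)" by (simp add: powr_def mult.commute)
  then show ?thesis using assms by (simp add: powr_mult)
qed

context profile_flow
begin

text \<open>The bound on \<open>V\<close> gives \<open>(|X|\<^sup>2)' \<ge> 2 (b - 2 \<epsilon>) (|X|\<^sup>2 - R\<^sup>2)\<close> at every point of the trajectory, inside
  the ball of radius \<open>R\<close> as well; so \<open>|X|\<^sup>2 - R\<^sup>2\<close> grows from its nonnegative initial value without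
  any argument about a first exit time.\<close>

lemma flow_escapes:
  assumes V_le: "\<And>y r. norm (V y r) \<le> M + \<epsilon> * norm y"
    and \<epsilon>: "0 < \<epsilon>" "2 * \<epsilon> < b"
    and R: "M\<^sup>2 / (2 * \<epsilon>) \<le> 2 * (b - 2 * \<epsilon>) * R\<^sup>2" "0 \<le> R" "R \<le> norm c"
    and t: "t \<in> {0..T}"
  shows "norm c \<le> norm (X c t)"
proof -
  let ?k = "2 * (b - 2 * \<epsilon>)"
  have "exp (?k * t) * ((norm (X c 0))\<^sup>2 - R\<^sup>2) \<le> (norm (X c t))\<^sup>2 - R\<^sup>2"
  proof (rule exponential_lower_comparison[OF _ _ t])
    fix r assume r: "r \<in> {0..T}"
    let ?x = "X c r"
    show "((\<lambda>t. (norm (X c t))\<^sup>2 - R\<^sup>2) has_vector_derivative 2 * (?x \<bullet> drift r ?x)) (at r within {0..T})"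
      using has_vector_derivative_diff[OF norm_square_has_derivative[OF X_der[OF r, of c]]
          has_vector_derivative_const[of "R\<^sup>2"]] by simp
    have "0 \<le> (M - 2 * \<epsilon> * norm ?x)\<^sup>2 / (2 * \<epsilon>)" using \<epsilon> by simp
    also have "\<dots> = M\<^sup>2 / (2 * \<epsilon>) - 2 * M * norm ?x + 2 * \<epsilon> * (norm ?x)\<^sup>2"
      using \<epsilon> by (simp add: power2_eq_square field_simps)
    finally have young: "2 * M * norm ?x \<le> M\<^sup>2 / (2 * \<epsilon>) + 2 * \<epsilon> * (norm ?x)\<^sup>2" by simp
    have "- (?x \<bullet> V ?x (s + r)) \<le> norm ?x * norm (V ?x (s + r))"
      using Cauchy_Schwarz_ineq2[of ?x "V ?x (s + r)"] by linarith
    also have "\<dots> \<le> norm ?x * (M + \<epsilon> * norm ?x)" by (intro mult_left_mono V_le) auto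
    finally have "- (?x \<bullet> V ?x (s + r)) \<le> M * norm ?x + \<epsilon> * (norm ?x)\<^sup>2"
      by (simp add: power2_eq_square algebra_simps)
    then show "?k * ((norm ?x)\<^sup>2 - R\<^sup>2) \<le> 2 * (?x \<bullet> drift r ?x)"
      using young R(1) by (simp add: drift_def inner_add_right power2_norm_eq_inner[symmetric] algebra_simps)
  qed
  moreover have "0 \<le> (norm c)\<^sup>2 - R\<^sup>2" using R by (simp add: power_mono)
  moreover have "1 \<le> exp (?k * t)" using \<epsilon> t by simp
  ultimately have "(norm c)\<^sup>2 \<le> (norm (X c t))\<^sup>2"
    using mult_right_mono[of 1 "exp (?k * t)" "(norm c)\<^sup>2 - R\<^sup>2"] unfolding X_0 mult_1 by linarith
  then show ?thesis by (rule power2_le_imp_le) simp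
qed

text \<open>A trajectory that stays in the far region. There \<open>W\<close> and its Jacobian matrix differ from \<open>b y\<close> and
  \<open>b I\<close> by relative errors of order \<open>\<epsilon>\<close>, so distances from the origin and tangent vectors grow with
  rates close to \<open>b\<close>.\<close>

context
  fixes \<epsilon> R :: real and c :: "real^3"
  assumes V_far: "\<And>y r. R \<le> norm y \<Longrightarrow> norm (V y r) \<le> 2 * \<epsilon> * norm y"
    and J_far: "\<And>y r. R \<le> norm y \<Longrightarrow> norm (J y r) \<le> \<epsilon>"
    and X_far: "\<And>t. t \<in> {0..T} \<Longrightarrow> R \<le> norm (X c t)"
begin

lemma inner_V_far: "t \<in> {0..T} \<Longrightarrow> \<bar>X c t \<bullet> V (X c t) (s + t)\<bar> \<le> 2 * \<epsilon> * (norm (X c t))\<^sup>2"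
  using mult_left_mono[OF V_far[OF X_far], of t "norm (X c t)" "s + t"]
  by (intro order_trans[OF Cauchy_Schwarz_ineq2]) (simp add: power2_eq_square mult_ac)

lemma X_far_lower:
  assumes t: "t \<in> {0..T}"
  shows "exp ((b - 2 * \<epsilon>) * t) * norm c \<le> norm (X c t)"
proof (rule power2_le_imp_le)
  have "exp (2 * (b - 2 * \<epsilon>) * t) * (norm (X c 0))\<^sup>2 \<le> (norm (X c t))\<^sup>2"
  proof (rule exponential_lower_comparison[OF norm_square_has_derivative[OF X_der] _ t])
    fix r assume "r \<in> {0..T}"
    from inner_V_far[OF this]
    show "2 * (b - 2 * \<epsilon>) * (norm (X c r))\<^sup>2 \<le> 2 * (X c r \<bullet> drift r (X c r))"
      by (simp add: drift_def inner_add_right power2_norm_eq_inner[symmetric] algebra_simps abs_le_iff)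
  qed
  then show "(exp ((b - 2 * \<epsilon>) * t) * norm c)\<^sup>2 \<le> (norm (X c t))\<^sup>2"
    unfolding exp_mult_square by simp
qed simp

lemma X_far_upper:
  assumes t: "t \<in> {0..T}"
  shows "norm (X c t) \<le> exp ((b + 2 * \<epsilon>) * t) * norm c"
proof (rule power2_le_imp_le)
  have "(norm (X c t))\<^sup>2 \<le> exp (2 * (b + 2 * \<epsilon>) * t) * ((norm (X c 0))\<^sup>2 + 0 * t)"
  proof (rule exponential_comparison[OF norm_square_has_derivative[OF X_der] _ t])
    fix r assume "r \<in> {0..T}"
    from inner_V_far[OF this]
    show "2 * (X c r \<bullet> drift r (X c r)) \<le> 2 * (b + 2 * \<epsilon>) * (norm (X c r))\<^sup>2 + 0 * exp (2 * (b + 2 * \<epsilon>) * r)"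
      by (simp add: drift_def inner_add_right power2_norm_eq_inner[symmetric] algebra_simps abs_le_iff)
  qed
  then show "(norm (X c t))\<^sup>2 \<le> (exp ((b + 2 * \<epsilon>) * t) * norm c)\<^sup>2"
    unfolding exp_mult_square by simp
qed simp

lemma Y_far_lower:
  assumes t: "t \<in> {0..T}"
  shows "exp ((b - \<epsilon>) * t) * norm h \<le> norm (Y c t *v h)"
proof (rule power2_le_imp_le)
  have "exp (2 * (b - \<epsilon>) * t) * (norm (Y c 0 *v h))\<^sup>2 \<le> (norm (Y c t *v h))\<^sup>2"
  proof (rule exponential_lower_comparison[OF norm_square_has_derivative[OF Y_der] _ t])
    fix r assume r: "r \<in> {0..T}"
    let ?y = "Y c r *v h"
    have "\<bar>?y \<bullet> (J (X c r) (s + r) *v ?y)\<bar> \<le> norm ?y * norm (J (X c r) (s + r) *v ?y)"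
      by (rule Cauchy_Schwarz_ineq2)
    also have "\<dots> \<le> norm ?y * (\<epsilon> * norm ?y)"
      by (intro mult_left_mono order_trans[OF norm_matrix_vector_le] mult_right_mono J_far X_far r) auto
    finally show "2 * (b - \<epsilon>) * (norm ?y)\<^sup>2 \<le> 2 * (?y \<bullet> (drift_jacobian r (X c r) *v ?y))"
      by (simp add: drift_jacobian_v inner_add_right power2_norm_eq_inner[symmetric]
          power2_eq_square algebra_simps abs_le_iff)
  qed
  then show "(exp ((b - \<epsilon>) * t) * norm h)\<^sup>2 \<le> (norm (Y c t *v h))\<^sup>2"
    unfolding exp_mult_square by simp
qed simp

text \<open>The exponents add up: \<open>3 b\<close> from the volume, \<open>b \<eta>\<close> from the weight (by the lower or the upper bound
  on \<open>|X|\<close> according to the sign of \<open>\<eta>\<close>), and \<open>- q (a + 2 b - b) = - q\<close> from Cauchy's formula.\<close>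

lemma weighted_vorticity_expands:
  assumes q: "0 \<le> q" and \<epsilon>: "0 \<le> \<epsilon>" and R: "0 < R" and ab: "a + b = 1" and t: "t \<in> {0..T}"
  shows "exp ((b * (3 + \<eta>) - q - \<epsilon> * (q + 2 * \<bar>\<eta>\<bar>)) * t)
      * (norm (axial_vector (J c s)) powr q * norm c powr \<eta>)
    \<le> det (Y c t) * (norm (axial_vector (J (X c t) (s + t))) powr q * norm (X c t) powr \<eta>)"
proof -
  have c: "0 < norm c" using X_far[of 0] T_nonneg R by auto
  have x: "0 < norm (X c t)" using X_far[OF t] R by linarith
  have "exp ((b * \<eta> - 2 * \<epsilon> * \<bar>\<eta>\<bar>) * t) * norm c powr \<eta> \<le> norm (X c t) powr \<eta>"
  proof (cases "0 \<le> \<eta>")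
    case True
    then have "exp ((b * \<eta> - 2 * \<epsilon> * \<bar>\<eta>\<bar>) * t) * norm c powr \<eta> = (exp ((b - 2 * \<epsilon>) * t) * norm c) powr \<eta>"
      unfolding exp_mult_powr[OF norm_ge_zero] by (simp add: algebra_simps)
    also have "\<dots> \<le> norm (X c t) powr \<eta>"
      by (rule powr_mono2[OF True _ X_far_lower[OF t]]) simp
    finally show ?thesis .
  next
    case False
    then have "exp ((b * \<eta> - 2 * \<epsilon> * \<bar>\<eta>\<bar>) * t) * norm c powr \<eta> = (exp ((b + 2 * \<epsilon>) * t) * norm c) powr \<eta>"
      unfolding exp_mult_powr[OF norm_ge_zero] by (simp add: algebra_simps)
    also have "\<dots> \<le> norm (X c t) powr \<eta>"
      by (rule powr_mono2'[OF _ x X_far_upper[OF t]]) (use False in simp)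
    finally show ?thesis .
  qed
  moreover have "exp (- (1 + \<epsilon>) * q * t) * norm (axial_vector (J c s)) powr q
      \<le> norm (axial_vector (J (X c t) (s + t))) powr q"
  proof -
    have "exp (- (1 + \<epsilon>) * t) * norm (axial_vector (J c s))
        = exp (- (a + 2 * b) * t) * (exp ((b - \<epsilon>) * t) * norm (axial_vector (J c s)))"
    proof -
      have "- (1 + \<epsilon>) * t = - (a + 2 * b) * t + (b - \<epsilon>) * t"
        unfolding ab[symmetric] by (simp add: algebra_simps)
      then show ?thesis by (simp only: exp_add mult.assoc)
    qed
    also have "\<dots> \<le> exp (- (a + 2 * b) * t) * norm (Y c t *v axial_vector (J c s))"
      by (intro mult_left_mono Y_far_lower t) simp
    also have "\<dots> = norm (axial_vector (J (X c t) (s + t)))"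
      by (simp add: cauchy_vorticity_formula[OF t])
    finally have "(exp (- (1 + \<epsilon>) * t) * norm (axial_vector (J c s))) powr q
        \<le> norm (axial_vector (J (X c t) (s + t))) powr q"
      by (intro powr_mono2 q) auto
    also have "(exp (- (1 + \<epsilon>) * t) * norm (axial_vector (J c s))) powr q
        = exp (- (1 + \<epsilon>) * q * t) * norm (axial_vector (J c s)) powr q"
      unfolding exp_mult_powr[OF norm_ge_zero] by (simp add: mult_ac)
    finally show ?thesis .
  qed
  ultimately have "(exp (- (1 + \<epsilon>) * q * t) * norm (axial_vector (J c s)) powr q)
      * (exp ((b * \<eta> - 2 * \<epsilon> * \<bar>\<eta>\<bar>) * t) * norm c powr \<eta>)
    \<le> norm (axial_vector (J (X c t) (s + t))) powr q * norm (X c t) powr \<eta>"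
    by (intro mult_mono) auto
  from mult_left_mono[OF this, of "det (Y c t)"]
  have "exp (3 * b * t) * ((exp (- (1 + \<epsilon>) * q * t) * norm (axial_vector (J c s)) powr q)
      * (exp ((b * \<eta> - 2 * \<epsilon> * \<bar>\<eta>\<bar>) * t) * norm c powr \<eta>))
    \<le> det (Y c t) * (norm (axial_vector (J (X c t) (s + t))) powr q * norm (X c t) powr \<eta>)"
    by (simp add: det_Y[OF t])
  moreover have "exp ((b * (3 + \<eta>) - q - \<epsilon> * (q + 2 * \<bar>\<eta>\<bar>)) * t)
      = exp (3 * b * t) * (exp (- (1 + \<epsilon>) * q * t) * exp ((b * \<eta> - 2 * \<epsilon> * \<bar>\<eta>\<bar>) * t))"
    unfolding exp_add[symmetric] by (simp add: algebra_simps)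
  ultimately show ?thesis by (simp add: mult_ac)
qed

end

end

section \<open>Periodic profiles\<close>

lemma continuous_on_axial_vector:
  assumes "continuous_on S M"
  shows "continuous_on S (\<lambda>x. axial_vector (M x))"
proof -
  have "axial_vector N = (\<chi> i. if i = 1 then N$3$2 - N$2$3 else if i = 2 then N$1$3 - N$3$1 else N$2$1 - N$1$2)"
    for N :: "real^3^3"
    by (simp add: axial_vector_def vec_eq_iff forall_3)
  moreover have "continuous_on S (\<lambda>x. if i = 1 then M x$3$2 - M x$2$3 else
      if i = 2 then M x$1$3 - M x$3$1 else M x$2$1 - M x$1$2)" for i :: 3
    using assms by (cases "i = 1"; cases "i = 2") (auto intro!: continuous_intros)
  ultimately show ?thesis by (auto intro!: continuous_on_vec_lambda)
qed

text \<open>In the expansion argument the homogeneous weight \<open>|y|\<^sup>\<eta>\<close> is the convenient one, since it scales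
  exactly with the growth of trajectories; this bound transfers integrability to it.\<close>

lemma norm_powr_le_one_plus_norm_powr:
  assumes "1 \<le> norm y"
  shows "norm y powr \<eta> \<le> 2 powr \<bar>\<eta>\<bar> * (1 + norm y) powr \<eta>"
proof (cases "0 \<le> \<eta>")
  case True
  have "norm y powr \<eta> \<le> 1 * (1 + norm y) powr \<eta>" using True by (simp add: powr_mono2)
  also have "\<dots> \<le> 2 powr \<bar>\<eta>\<bar> * (1 + norm y) powr \<eta>"
    by (intro mult_right_mono ge_one_powr_ge_zero) auto
  finally show ?thesis .
next
  case False
  have "norm y powr \<eta> = 2 powr \<bar>\<eta>\<bar> * (2 * norm y) powr \<eta>"
    using False by (simp add: powr_mult powr_minus field_simps)
  also have "\<dots> \<le> 2 powr \<bar>\<eta>\<bar> * (1 + norm y) powr \<eta>"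
    using False assms by (intro mult_left_mono powr_mono2') (auto intro: add_pos_nonneg)
  finally show ?thesis .
qed

locale periodic_profile = profile_solution +
  fixes S\<^sub>0 :: real
  assumes period_pos: "0 < S\<^sub>0"
    and V_periodic: "\<And>y s. V y (s + S\<^sub>0) = V y s"
    and J_far: "\<And>\<epsilon>. 0 < \<epsilon> \<Longrightarrow> \<exists>R. \<forall>y s. R \<le> norm y \<longrightarrow> norm (J y s) \<le> \<epsilon>"
    and ab: "a + b = 1"
begin

abbreviation vorticity :: "real^3 \<Rightarrow> real \<Rightarrow> real^3"
  where "vorticity y s \<equiv> axial_vector (J y s)"

lemma J_periodic: "J y (s + S\<^sub>0) = J y s"
proof -
  have "((\<lambda>y. V y s) has_derivative (\<lambda>h. J y (s + S\<^sub>0) *v h)) (at y)"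
    using V_space_der[of "s + S\<^sub>0" y] by (simp add: V_periodic)
  from has_derivative_unique[OF this V_space_der]
  show ?thesis unfolding matrix_eq by (auto dest: fun_cong)
qed

lemma V_bounded_near:
  obtains M where "0 \<le> M" "\<And>y s. norm y \<le> R \<Longrightarrow> norm (V y s) \<le> M"
proof -
  have "bounded ((\<lambda>(y, s). V y s) ` (cball 0 R \<times> {0..S\<^sub>0}))"
    by (intro compact_imp_bounded compact_continuous_image continuous_on_subset[OF V_cont] compact_Times) auto
  then obtain M where M: "\<forall>v\<in>(\<lambda>(y, s). V y s) ` (cball 0 R \<times> {0..S\<^sub>0}). norm v \<le> M"
    unfolding bounded_iff by blast
  have "norm (V y s) \<le> \<bar>M\<bar>" if y: "norm y \<le> R" for y s
  proof -
    obtain r where r: "r \<in> {0..<S\<^sub>0}" "V y s = V y r"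
      by (rule periodic_reduce[of S\<^sub>0 "V y" s]) (use period_pos V_periodic in auto)
    have "norm (V y r) \<le> M" using M r(1) y by force
    with r(2) show ?thesis by simp
  qed
  with that[of "\<bar>M\<bar>"] show ?thesis by simp
qed

text \<open>\<open>R\<close> is chosen independently of the time \<open>s\<close>: large enough that \<open>|\<nabla>V| \<le> \<epsilon>\<close> and \<open>|V| \<le> 2 \<epsilon> |y|\<close> outside,
  and that trajectories cannot return. Then the weighted vorticity at time \<open>s\<close> is a density which
  the period map expands.\<close>

lemma vorticity_vanishes_far:
  assumes q: "0 < q" "q < b * (3 + \<eta>)"
  obtains R where "\<And>s y. integrable lborel (\<lambda>y. norm (vorticity y s) powr q * (1 + norm y) powr \<eta>) \<Longrightarrow>
    R < norm y \<Longrightarrow> vorticity y s = 0"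
proof -
  obtain e where e: "0 < e" "(q + 2 * \<bar>\<eta>\<bar>) * e < b * (3 + \<eta>) - q"
    using small_factor[of "q + 2 * \<bar>\<eta>\<bar>" "b * (3 + \<eta>) - q"] q by auto
  define \<epsilon> where "\<epsilon> = min e (b / 4)"
  have \<epsilon>: "0 < \<epsilon>" "2 * \<epsilon> < b" using e(1) b_pos by (auto simp: \<epsilon>_def)
  have "\<epsilon> * (q + 2 * \<bar>\<eta>\<bar>) \<le> (q + 2 * \<bar>\<eta>\<bar>) * e"
    using q by (subst mult.commute) (auto simp: \<epsilon>_def intro!: mult_left_mono)
  with e have gain: "0 < b * (3 + \<eta>) - q - \<epsilon> * (q + 2 * \<bar>\<eta>\<bar>)" by linarith
  obtain R1 where R1: "\<And>y s. R1 \<le> norm y \<Longrightarrow> norm (J y s) \<le> \<epsilon>"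
    using J_far[OF \<epsilon>(1)] by blast
  obtain M where M: "0 \<le> M" "\<And>y s. norm y \<le> \<bar>R1\<bar> + 1 \<Longrightarrow> norm (V y s) \<le> M"
    by (rule V_bounded_near[of "\<bar>R1\<bar> + 1"]) (rule that)
  have V_le: "norm (V y s) \<le> M + \<epsilon> * norm y" for y s
  proof (rule norm_le_affine_if_derivative_small_far[where R = "\<bar>R1\<bar> + 1", OF V_space_der])
    show "norm (J x s *v h) \<le> \<epsilon> * norm h" if "\<bar>R1\<bar> + 1 \<le> norm x" for x h
      using that by (intro order_trans[OF norm_matrix_vector_le] mult_right_mono R1) auto
  qed (use M \<epsilon> in auto)
  \<comment> \<open>The four summands of \<open>R\<close> serve to make \<open>|\<nabla>V| \<le> \<epsilon>\<close>, to keep away from the origin, to absorb \<open>M\<close> into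
    \<open>\<epsilon> |y|\<close>, and to meet the condition of \<open>flow_escapes\<close>, which reads \<open>m \<le> R\<^sup>2\<close>.\<close>
  define m where "m = M\<^sup>2 / (2 * \<epsilon>) / (2 * (b - 2 * \<epsilon>))"
  have m: "0 \<le> m" using \<epsilon> by (simp add: m_def)
  define R where "R = \<bar>R1\<bar> + 1 + M / \<epsilon> + sqrt m"
  have R: "R1 \<le> R" "1 \<le> R" "M / \<epsilon> \<le> R" "sqrt m \<le> R"
  proof -
    have "0 \<le> M / \<epsilon>" "0 \<le> sqrt m" using M(1) \<epsilon>(1) m by simp_all
    then show "R1 \<le> R" "1 \<le> R" "M / \<epsilon> \<le> R" "sqrt m \<le> R" unfolding R_def by linarith+
  qed
  have "m \<le> R\<^sup>2" using R(4) m by (simp add: real_le_rsqrt sqrt_le_D)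
  then have R_escape: "M\<^sup>2 / (2 * \<epsilon>) \<le> 2 * (b - 2 * \<epsilon>) * R\<^sup>2"
  proof -
    have "2 * (b - 2 * \<epsilon>) * m = M\<^sup>2 / (2 * \<epsilon>)" using \<epsilon>(2) by (simp add: m_def)
    moreover have "2 * (b - 2 * \<epsilon>) * m \<le> 2 * (b - 2 * \<epsilon>) * R\<^sup>2"
      using \<open>m \<le> R\<^sup>2\<close> \<epsilon>(2) by (intro mult_left_mono) auto
    ultimately show ?thesis by simp
  qed
  have V_far: "norm (V y s) \<le> 2 * \<epsilon> * norm y" if "R \<le> norm y" for y s
  proof -
    have "M \<le> \<epsilon> * R" using R(3) \<epsilon>(1) by (simp add: pos_divide_le_eq mult.commute)
    also have "\<dots> \<le> \<epsilon> * norm y" using that \<epsilon>(1) by simp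
    finally show ?thesis using V_le[of y s] by simp
  qed
  show ?thesis
  proof
    fix s and y :: "real^3"
    assume int: "integrable lborel (\<lambda>y. norm (vorticity y s) powr q * (1 + norm y) powr \<eta>)"
      and y: "R < norm y"
    interpret F: profile_flow V J Vt G P a b K s S\<^sub>0
      by unfold_locales (use period_pos in simp)
    let ?S = "{y :: real^3. R < norm y}"
    let ?F = "\<lambda>y. norm (vorticity y s) powr q * norm y powr \<eta>"
    have S0: "S\<^sub>0 \<in> {0..S\<^sub>0}" using period_pos by simp
    have escape: "norm c \<le> norm (F.X c t)" if "R \<le> norm c" "t \<in> {0..S\<^sub>0}" for c t
      by (rule F.flow_escapes[OF V_le \<epsilon> R_escape _ that]) (use R in simp)
    have S_open: "open ?S" by (intro open_Collect_less continuous_intros)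
    have vort_cont: "continuous_on S (\<lambda>y. vorticity y s)" for S
      by (intro continuous_on_axial_vector J_cont_comp continuous_intros)
    have F_cont: "continuous_on ?S ?F"
      using q R by (intro continuous_intros continuous_on_powr' vort_cont) auto
    have "?F y = 0"
    proof (rule expanding_self_map_vanishing[of ?S "\<lambda>c. F.X c S\<^sub>0" "\<lambda>c h. F.Y c S\<^sub>0 *v h"])
      show "open ?S" by (rule S_open)
      show "((\<lambda>c. F.X c S\<^sub>0) has_derivative (*v) (F.Y x S\<^sub>0)) (at x)" for x
        by (rule F.X_has_derivative[OF S0])
      show "inj_on (\<lambda>c. F.X c S\<^sub>0) ?S" using F.X_inj[OF S0] by (auto intro: inj_onI)
      show "(\<lambda>c. F.X c S\<^sub>0) ` ?S \<subseteq> ?S"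
      proof clarsimp
        fix c :: "real^3" assume "R < norm c"
        then show "R < norm (F.X c S\<^sub>0)" using escape[of c S\<^sub>0] S0 by linarith
      qed
      show "continuous_on ?S ?F" by (rule F_cont)
      show "?F absolutely_integrable_on ?S"
      proof (rule measurable_bounded_by_integrable_imp_absolutely_integrable)
        show S_leb: "?S \<in> sets lebesgue" using S_open by (simp add: borel_open)
        show "?F \<in> borel_measurable (lebesgue_on ?S)"
          by (rule continuous_imp_measurable_on_sets_lebesgue[OF F_cont S_leb])
        have "(\<lambda>y. norm (vorticity y s) powr q * (1 + norm y) powr \<eta>) absolutely_integrable_on UNIV"
          using integrable_on_lborel[OF int] by (intro nonnegative_absolutely_integrable_1) auto
        then have "(\<lambda>y. norm (vorticity y s) powr q * (1 + norm y) powr \<eta>) absolutely_integrable_on ?S"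
          by (rule set_integrable_subset) (use S_leb in auto)
        then show "(\<lambda>y. 2 powr \<bar>\<eta>\<bar> * (norm (vorticity y s) powr q * (1 + norm y) powr \<eta>)) integrable_on ?S"
          using integrable_cmul[of _ ?S "2 powr \<bar>\<eta>\<bar>"] by (simp add: absolutely_integrable_on_def)
        fix y :: "real^3" assume "y \<in> ?S"
        then have "1 \<le> norm y" using R by simp
        from mult_left_mono[OF norm_powr_le_one_plus_norm_powr[OF this, of \<eta>], of "norm (vorticity y s) powr q"]
        show "norm (?F y) \<le> 2 powr \<bar>\<eta>\<bar> * (norm (vorticity y s) powr q * (1 + norm y) powr \<eta>)"
          by (simp add: mult_ac)
      qed
      let ?g = "b * (3 + \<eta>) - q - \<epsilon> * (q + 2 * \<bar>\<eta>\<bar>)"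
      show "1 < exp (?g * S\<^sub>0)" using gain period_pos by simp
      fix c :: "real^3" assume c: "c \<in> ?S"
      have X_far: "R \<le> norm (F.X c t)" if "t \<in> {0..S\<^sub>0}" for t
        using escape[of c t] that c by simp
      have "exp (?g * S\<^sub>0) * ?F c \<le> det (F.Y c S\<^sub>0) *
          (norm (vorticity (F.X c S\<^sub>0) (s + S\<^sub>0)) powr q * norm (F.X c S\<^sub>0) powr \<eta>)"
        by (rule F.weighted_vorticity_expands[where R = R, OF V_far R1])
          (use R X_far q \<epsilon> ab S0 in auto)
      then show "exp (?g * S\<^sub>0) * ?F c \<le> \<bar>det (matrix ((*v) (F.Y c S\<^sub>0)))\<bar> * ?F (F.X c S\<^sub>0)"
        by (simp add: J_periodic F.det_Y[OF S0])
    qed (use y in auto)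
    then show "vorticity y s = 0" using y R by auto
  qed
qed

text \<open>By Cauchy's formula the period map sends the set where the vorticity at time \<open>s\<close> is nonzero into itself,
  and it multiplies volumes by \<open>exp (3 b S\<^sub>0)\<close>; a bounded open set can only be empty.\<close>

lemma vorticity_vanishes_if_compactly_supported:
  assumes far: "\<And>y. R < norm y \<Longrightarrow> vorticity y s = 0"
  shows "vorticity y s = 0"
proof (rule ccontr)
  assume y: "vorticity y s \<noteq> 0"
  interpret F: profile_flow V J Vt G P a b K s S\<^sub>0
    by unfold_locales (use period_pos in simp)
  have S0: "S\<^sub>0 \<in> {0..S\<^sub>0}" using period_pos by simp
  let ?U = "{y. vorticity y s \<noteq> 0}"
  have U: "open ?U"
    by (intro open_Collect_neq continuous_on_axial_vector J_cont_comp continuous_intros)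
  have "?U \<subseteq> cball 0 R" using far by (force simp: not_less[symmetric])
  then have "bounded ?U" using bounded_subset bounded_cball by blast
  then have U_meas: "?U \<in> lmeasurable" using U by (rule lmeasurable_open)
  have "(1 :: real) = 0"
  proof (rule expanding_self_map_vanishing[of ?U "\<lambda>c. F.X c S\<^sub>0" "\<lambda>c h. F.Y c S\<^sub>0 *v h" "\<lambda>_. 1"])
    show "((\<lambda>c. F.X c S\<^sub>0) has_derivative (*v) (F.Y x S\<^sub>0)) (at x)" for x
      by (rule F.X_has_derivative[OF S0])
    show "inj_on (\<lambda>c. F.X c S\<^sub>0) ?U" using F.X_inj[OF S0] by (auto intro: inj_onI)
    show "(\<lambda>c. F.X c S\<^sub>0) ` ?U \<subseteq> ?U"
    proof clarsimp
      fix c assume c: "vorticity c s \<noteq> 0" and "vorticity (F.X c S\<^sub>0) s = 0"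
      then have "F.Y c S\<^sub>0 *v vorticity c s = 0"
        using F.cauchy_vorticity_formula[OF S0, of c] by (simp add: J_periodic)
      moreover have "invertible (F.Y c S\<^sub>0)"
        unfolding invertible_det_nz F.det_Y[OF S0] by simp
      ultimately show False
        using c by (metis matrix_left_invertible_ker invertible_left_inverse)
    qed
    show "(\<lambda>_. 1 :: real) absolutely_integrable_on ?U"
      using U_meas by (simp add: lmeasurable_iff_integrable_on absolutely_integrable_on_def)
    show "1 < exp (3 * b * S\<^sub>0)" using b_pos period_pos by simp
    show "exp (3 * b * S\<^sub>0) * 1 \<le> \<bar>det (matrix ((*v) (F.Y x S\<^sub>0)))\<bar> * 1" for x
      by (simp add: F.det_Y[OF S0])
  qed (use U y in auto)
  then show False by simp
qed

text \<open>The integrability hypothesis gives a finite spatial integral for almost every time only.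
  For these times the vorticity vanishes, and continuity in time extends this to all times.\<close>

theorem vorticity_eq_0:
  assumes q: "0 < q" "q < b * (3 + \<eta>)"
    and int: "(\<integral>\<^sup>+s\<in>{0..S\<^sub>0}. (\<integral>\<^sup>+y. ennreal (norm (vorticity y s) powr q * (1 + norm y) powr \<eta>) \<partial>lborel) \<partial>lborel) < \<infinity>"
  shows "vorticity y s = 0"
proof (rule ccontr)
  assume nz: "vorticity y s \<noteq> 0"
  let ?w = "\<lambda>s y. norm (vorticity y s) powr q * (1 + norm y) powr \<eta>"
  obtain R where R: "\<And>s y. integrable lborel (?w s) \<Longrightarrow> R < norm y \<Longrightarrow> vorticity y s = 0"
    by (rule vorticity_vanishes_far[OF q]) blast
  have vort_cont: "continuous_on UNIV (\<lambda>p. vorticity (snd p) (fst p))"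
    by (intro continuous_on_axial_vector J_cont_comp continuous_intros)
  have [measurable]: "(\<lambda>p. vorticity (snd p) (fst p)) \<in> borel_measurable (borel \<Otimes>\<^sub>M borel)"
    unfolding borel_prod by (rule borel_measurable_continuous_onI[OF vort_cont])
  have w_meas: "(\<lambda>(s, y). ennreal (?w s y)) \<in> borel_measurable (lborel \<Otimes>\<^sub>M lborel)"
    unfolding measurable_cong_sets[OF sets_pair_measure_cong[OF sets_lborel sets_lborel] refl] split_beta
    by measurable
  have "AE r in lborel. (\<integral>\<^sup>+y. ennreal (?w r y) \<partial>lborel) * indicator {0..S\<^sub>0} r \<noteq> \<infinity>"
    using int lborel.borel_measurable_nn_integral[OF w_meas] by (intro nn_integral_PInf_AE) auto
  then have "AE r in lborel. r \<in> {0..S\<^sub>0} \<longrightarrow> (\<forall>y. vorticity y r = 0)"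
  proof eventually_elim
    case (elim r)
    show ?case
    proof (intro impI allI)
      fix y assume r: "r \<in> {0..S\<^sub>0}"
      have "(\<lambda>y. ?w r y) \<in> borel_measurable lborel"
        using measurable_compose[OF measurable_Pair1'[of r borel borel]
            \<open>(\<lambda>p. vorticity (snd p) (fst p)) \<in> borel_measurable (borel \<Otimes>\<^sub>M borel)\<close>] by simp
      then have int_r: "integrable lborel (?w r)"
        using elim r by (intro integrableI_bounded) (auto simp: top.not_eq_extremum)
      show "vorticity y r = 0"
        by (rule vorticity_vanishes_if_compactly_supported[where R = R]) (rule R[OF int_r])
    qed
  qed
  then obtain N where N: "N \<in> null_sets lborel" "{r. \<not> (r \<in> {0..S\<^sub>0} \<longrightarrow> (\<forall>y. vorticity y r = 0))} \<subseteq> N"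
    by (auto simp: eventually_ae_filter)
  obtain r where r: "r \<in> {0..<S\<^sub>0}" "vorticity y s = vorticity y r"
    by (rule periodic_reduce[of S\<^sub>0 "vorticity y" s]) (use period_pos J_periodic in auto)
  have "continuous_on UNIV (\<lambda>s. vorticity y s)"
    by (intro continuous_on_axial_vector J_cont_comp continuous_intros)
  then have "open {s. vorticity y s \<noteq> 0}" by (intro open_Collect_neq) (auto intro: continuous_intros)
  then obtain d where d: "d > 0" "\<And>t. dist t r < d \<Longrightarrow> vorticity y t \<noteq> 0"
    using nz r(2) unfolding open_dist by auto
  have "{r<..<min (r + d) S\<^sub>0} \<subseteq> N"
  proof
    fix t assume t: "t \<in> {r<..<min (r + d) S\<^sub>0}"
    then have "vorticity y t \<noteq> 0" by (intro d) (auto simp: dist_real_def)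
    moreover have "t \<in> {0..S\<^sub>0}" using t r by auto
    ultimately show "t \<in> N" using N(2) by auto
  qed
  from null_sets_subset[OF N(1) _ this]
  have "emeasure lborel {r<..<min (r + d) S\<^sub>0} = 0" by (simp add: null_setsD1)
  then show False using d r by (auto simp: min_def split: if_splits)
qed

end

theorem theorem1p4:
  fixes \<alpha> \<eta> q S\<^sub>0 :: real
    and V :: "real^3 \<Rightarrow> real \<Rightarrow> real^3"
    and P :: "real^3 \<Rightarrow> real \<Rightarrow> real"
    and \<Omega> :: "real^3 \<Rightarrow> real \<Rightarrow> real^3"
  defines "\<Omega> \<equiv> \<lambda>y s. curl (\<lambda>x. V x s) y"
  assumes "\<alpha> > -1" and "\<eta> > -3"
    and "q \<in> {0<..<(3 + \<eta>) / (1 + \<alpha>)}"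
    and "S\<^sub>0 > 0"
    and "C1 (\<lambda>(y, s). V y s)"
    and "\<And>y s. V y s = V y (s + S\<^sub>0)"
    and "solves_profile_equations \<alpha> V P"
    and "((\<lambda>y. SUP s\<in>{0<..<S\<^sub>0}. norm (jacobian (\<lambda>x. V x s) (at y))) \<longlongrightarrow> 0) at_infinity"
    and "(\<integral>\<^sup>+s\<in>{0..S\<^sub>0}. (\<integral>\<^sup>+y. ennreal (norm (\<Omega> y s) powr q * (1 + norm y) powr \<eta>) \<partial>lborel) \<partial>lborel) < \<infinity>"
  shows "(\<forall>y s. \<Omega> y s = 0) \<and>
    ((\<forall>s\<in>{0..<S\<^sub>0}. ((\<lambda>y. V y s) \<longlongrightarrow> 0) at_infinity) \<longrightarrow> (\<forall>y s. V y s = 0))"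
proof -
  obtain f' :: "(real^3) \<times> real \<Rightarrow> ((real^3) \<times> real) \<Rightarrow>\<^sub>L (real^3)"
    where f': "\<And>p. ((\<lambda>(y, s). V y s) has_derivative blinfun_apply (f' p)) (at p)"
    and f'_cont: "continuous_on UNIV f'"
    using assms(6) unfolding C1_def by blast
  define J where "J y s = jacobian (\<lambda>x. V x s) (at y)" for y s
  define Vt where "Vt y s = vector_derivative (\<lambda>t. V y t) (at s)" for y s
  have J_v: "J y s *v h = f' (y, s) (h, 0)" for y s h
  proof -
    have "((\<lambda>y. (y, s)) has_derivative (\<lambda>h. (h, 0))) (at y)"
      by (auto intro!: derivative_eq_intros)
    from has_derivative_compose[OF this f']
    have der: "((\<lambda>x. V x s) has_derivative (\<lambda>h. f' (y, s) (h, 0))) (at y)" by simp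
    then have "((\<lambda>x. V x s) has_derivative (\<lambda>h. J y s *v h)) (at y)"
      unfolding J_def by (metis differentiable_def jacobian_works)
    from has_derivative_unique[OF this der] show ?thesis by (rule fun_cong)
  qed
  have Vt_eq: "Vt y s = f' (y, s) (0, 1)" for y s
  proof -
    have "((\<lambda>t. (y, t)) has_vector_derivative (0, 1)) (at s)"
      by (auto intro!: derivative_eq_intros has_vector_derivative_Pair)
    from vector_derivative_diff_chain_within[OF this has_derivative_at_withinI[OF f']]
    have "((\<lambda>t. V y t) has_vector_derivative f' (y, s) (0, 1)) (at s)" by (simp add: o_def)
    then show ?thesis unfolding Vt_def by (rule vector_derivative_at)
  qed
  have V_der: "((\<lambda>(y, s). V y s) has_derivative (\<lambda>(h, r). J y s *v h + r *\<^sub>R Vt y s)) (at (y, s))" for y s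
  proof -
    have "blinfun_apply (f' (y, s)) = (\<lambda>(h, r). J y s *v h + r *\<^sub>R Vt y s)"
    proof (rule ext, clarify)
      fix h :: "real^3" and r :: real
      have "(h, r) = (h, 0) + r *\<^sub>R (0, 1 :: real)" by simp
      then have "f' (y, s) (h, r) = f' (y, s) (h, 0) + r *\<^sub>R f' (y, s) (0, 1)"
        by (metis blinfun.add_right blinfun.scaleR_right)
      then show "f' (y, s) (h, r) = J y s *v h + r *\<^sub>R Vt y s"
        by (simp add: J_v Vt_eq)
    qed
    then show ?thesis using f'[of "(y, s)"] by simp
  qed
  have J_cont: "continuous_on UNIV (\<lambda>(y, s). J y s)"
  proof -
    have "J y s = (\<chi> i j. f' (y, s) (axis j 1, 0) $ i)" for y s
      by (simp add: J_v[symmetric] vec_eq_iff matrix_vector_mult_basis column_def)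
    then show ?thesis
      by (simp add: split_beta) (intro continuous_intros continuous_on_vec_lambda f'_cont)
  qed
  have J_time_cont: "continuous_on S (J y)" for S y
    using continuous_on_compose2[OF J_cont continuous_on_Pair[OF continuous_on_const continuous_on_id]]
    by simp
  have Vt_cont: "continuous_on UNIV (\<lambda>(y, s). Vt y s)"
    unfolding Vt_eq split_beta by (simp add: continuous_intros f'_cont)
  have J_per: "J y (s + S\<^sub>0) = J y s" for y s
    unfolding J_def using assms(7) by simp
  obtain G where G: "\<And>y s. GDERIV (\<lambda>x. P x s) y :> G y s"
    "\<And>y s. Vt y s + (\<alpha> / (\<alpha> + 1)) *\<^sub>R V y s + (1 / (\<alpha> + 1)) *\<^sub>R (J y s *v y) + J y s *v V y s = - G y s"
    using assms(8) unfolding solves_profile_equations_def Vt_def J_def by metis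
  have trace: "trace (J y s) = 0" for y s
    using assms(8) unfolding solves_profile_equations_def divergence_def J_def trace_def by simp
  have far: "\<exists>R. \<forall>y s. R \<le> norm y \<longrightarrow> norm (J y s) \<le> \<epsilon>" if \<epsilon>: "0 < \<epsilon>" for \<epsilon>
  proof -
    obtain R where R: "\<And>y. R \<le> norm y \<Longrightarrow> \<bar>SUP s\<in>{0<..<S\<^sub>0}. norm (J y s)\<bar> < \<epsilon>"
      using tendstoD[OF assms(9) \<epsilon>] by (auto simp: eventually_at_infinity J_def)
    have "norm (J y s) \<le> \<epsilon>" if y: "R \<le> norm y" for y s
    proof -
      have cont: "continuous_on S (\<lambda>s. norm (J y s))" for S
        by (intro continuous_intros J_time_cont)
      \<comment> \<open>The supremum of an unbounded set of reals carries no information, so boundedness in time comes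
        first. The estimate on the open interval extends to time \<open>0\<close> by continuity.\<close>
      have "bdd_above ((\<lambda>s. norm (J y s)) ` {0..S\<^sub>0})"
        by (intro bounded_imp_bdd_above compact_imp_bounded compact_continuous_image cont) simp
      then have bdd: "bdd_above ((\<lambda>s. norm (J y s)) ` {0<..<S\<^sub>0})"
        by (rule bdd_above_mono) auto
      have interior: "norm (J y s) \<le> \<epsilon>" if "s \<in> {0<..<S\<^sub>0}" for s
        using cSUP_upper[OF that bdd] R[OF y] by linarith
      obtain r where r: "r \<in> {0..<S\<^sub>0}" "J y s = J y r"
        by (rule periodic_reduce[of S\<^sub>0 "J y" s]) (use assms(5) J_per in auto)
      have "norm (J y r) \<le> \<epsilon>"
        by (rule continuous_le_on_closure[OF cont[of "closure {0<..<S\<^sub>0}"] _ interior]) (use r assms(5) in auto)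
      with r show ?thesis by simp
    qed
    then show ?thesis by blast
  qed
  obtain R where R: "\<And>y s. R \<le> norm y \<Longrightarrow> norm (J y s) \<le> 1"
    using far[of 1] by auto
  have "bounded ((\<lambda>(y, s). J y s) ` (cball 0 R \<times> {0..S\<^sub>0}))"
    by (intro compact_imp_bounded compact_continuous_image continuous_on_subset[OF J_cont] compact_Times) auto
  then obtain M where M: "\<forall>v\<in>(\<lambda>(y, s). J y s) ` (cball 0 R \<times> {0..S\<^sub>0}). norm v \<le> M"
    unfolding bounded_iff by blast
  have J_le: "norm (J y s) \<le> max 1 M" for y s
  proof (cases "R \<le> norm y")
    case True
    then show ?thesis using R by (simp add: le_max_iff_disj)
  next
    case False
    obtain r where r: "r \<in> {0..<S\<^sub>0}" "J y s = J y r"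
      by (rule periodic_reduce[of S\<^sub>0 "J y" s]) (use assms(5) J_per in auto)
    have "norm (J y r) \<le> M" using M r(1) False by force
    then show ?thesis using r(2) by simp
  qed
  interpret periodic_profile V J Vt G P "\<alpha> / (\<alpha> + 1)" "1 / (\<alpha> + 1)" "max 1 M" S\<^sub>0
    by unfold_locales
      (use V_der J_cont Vt_cont J_le trace G assms(2,5,7) far in \<open>auto simp: field_simps\<close>)
  have \<Omega>: "\<Omega> y s = axial_vector (J y s)" for y s
    unfolding \<Omega>_def curl_def axial_vector_def J_def Let_def ..
  have vort: "axial_vector (J y s) = 0" for y s
    by (rule vorticity_eq_0[of q \<eta>]) (use assms(2,4,10) in \<open>auto simp: \<Omega> field_simps\<close>)
  have "V y s = 0" if lim: "\<forall>s\<in>{0..<S\<^sub>0}. ((\<lambda>y. V y s) \<longlongrightarrow> 0) at_infinity" for y s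
  proof -
    obtain r where r: "r \<in> {0..<S\<^sub>0}" "V y s = V y r"
      by (rule periodic_reduce[of S\<^sub>0 "V y" s]) (use assms(5,7) in auto)
    have "V y r = 0"
    proof (rule curl_div_free_field_eq_0[OF V_space_der])
      show "continuous_on UNIV (\<lambda>y. J y r)" by (intro J_cont_comp continuous_intros)
      show "(J x r *v h) \<bullet> k = (J x r *v k) \<bullet> h" for x h k
        using axial_vector_inner_cross[of "J x r" h k] vort[of x r] by simp
    qed (use trace lim r in auto)
    with r show ?thesis by simp
  qed
  then show ?thesis using vort by (simp add: \<Omega>)
qed

end
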